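(* Let $n\ge d\ge2$, and consider polynomial dynamics of degree $K$ with parameter $\theta=(\theta_0,\dots,\theta_K)\in\mathbb{R}^k$, $k=K+1$, producing probability matrices $P(t;\theta)$, $t=0,1,\dots,T$, observed through Bernoulli adjacency matrices as in the context. Assume: (1) $\theta$ belongs to an open parameter set $\Theta\subset\mathbb{R}^k$, and the true parameter is an interior point. (2) For each $t,i,j$, the map $\theta\mapsto P_{ij}(t;\theta)$ is $C^1$, with $0<P_{ij}(t;\theta)<1$ on a neighborhood of the true parameter. (3) The score is integrable and differentiation can be interchanged with expectation (standard Fisher regularity), so the information identity is valid. (4) The Fisher information matrix $\mathcal{I}(\theta)$ is positive definite on the identifiable parameter subspace. Then any unbiased estimator $\hat\theta$ satisfies $$\mathbb{E}\big[\|\hat\theta-\theta\|^2\big]\ge\operatorname{tr}\big(\mathcal{I}(\theta)^{-1}\big).$$ The Fisher information matrix $\mathcal{I}(\theta)$ has entries $$\mathcal{I}(\theta)_{ab}=\sum_{t=0}^T\sum_{\iota,\gamma=1}^d\frac{\partial\lambda_\iota}{\partial\theta_a}\frac{\partial\lambda_\gamma}{\partial\theta_b}\cdot C_{\iota\gamma}(t),\qquad C_{\iota\gamma}(t)=\sum_{i<j}\frac{U_{i\iota}U_{j\iota}U_{i\gamma}U_{j\gamma}}{P_{ij}(t)(1-P_{ij}(t))}.$$ The diagonal entries $C_{\iota\iota}(t)=\mathcal{W}_\iota(t)$ measure the information content of eigenvalue direction $\iota$ at time $t$; the off-diagonal entries $C_{\iota\gamma}(t)$, $\iota\ne\gamma$,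 capture cross-eigenvalue correlations. A baseline lower bound on each parameter's variance follows from the matrix inequality $(\mathcal{I}^{-1})_{aa}\ge 1/\mathcal{I}_{aa}$: $$\operatorname{Var}(\hat\theta_a)\ge\frac{1}{\mathcal{I}_{aa}}=\frac{1}{\sum_t\sum_\iota\big(\frac{\partial\lambda_\iota}{\partial\theta_a}\big)^2\mathcal{W}_\iota(t)+\text{cross terms}},$$ where the cross terms are the contributions to $\mathcal{I}_{aa}$ of the pairs $\iota\ne\gamma$. Non-zero cross-eigenvalue terms arising from structured graphs (where the Fisher weights $1/[P_{ij}(1-P_{ij})]$ correlate with eigenvector components) can only increase the true Cramér–Rao bound above this baseline.
   Context: Polynomial dynamics of degree $K$: $\dot X=\big(\sum_{k=0}^K\theta_kP^k\big)X$ with $P=XX^\top$, $X(t)\in\mathbb{R}^{n\times d}$ of rank $d$, started from an initial state $X(0)$ that does not depend on $\theta$; hence $\dot P=2\sum_{k=0}^K\theta_kP^{k+1}$. Under these dynamics the eigenvectors of $P$ are stationary: $P(t;\theta)=U\Lambda(t;\theta)U^\top$, where $U\in\mathbb{R}^{n\times d}$ is a fixed matrix of orthonormal eigenvectors of $P$ for its nonzero eigenvalues, and $\Lambda=\operatorname{diag}(\lambda_1,\dots,\lambda_d)$ with $\lambda_\iota=\lambda_\iota(t;\theta)$ solving $\dot\lambda_\iota=2\sum_{k=0}^K\theta_k\lambda_\iota^{k+1}$. Consequently $\partial P_{ij}/\partial\theta_a=\sum_{\iota=1}^dU_{i\iota}U_{j\iota}\,\partial\lambda_\iota/\partial\theta_a$.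 Data: adjacency matrices $A^{(t)}$, $t=0,\dots,T$, with $A^{(t)}_{ij}\sim\mathrm{Bernoulli}(P_{ij}(t;\theta))$ for $i<j$, all entries conditionally independent given $P(t;\theta)$. The log-likelihood is $\ell(\theta)=\sum_{t=0}^T\sum_{i<j}\big[A^{(t)}_{ij}\log P_{ij}(t;\theta)+(1-A^{(t)}_{ij})\log(1-P_{ij}(t;\theta))\big]$, and the Fisher information matrix $\mathcal{I}(\theta)\in\mathbb{R}^{k\times k}$ is $$\mathcal{I}(\theta)_{ab}=\sum_{t=0}^T\sum_{i<j}\frac{\partial P_{ij}}{\partial\theta_a}\frac{\partial P_{ij}}{\partial\theta_b}\cdot\frac{1}{P_{ij}(1-P_{ij})}.$$ The identifiable parameter subspace is the subspace of parameter directions in $\mathbb{R}^k$ that are identifiable from the data. If $\mathcal{I}(\theta)$ is singular on $\mathbb{R}^k$, the statement is understood on this subspace, with the Moore–Penrose pseudoinverse $\mathcal{I}^+$ in place of $\mathcal{I}^{-1}$. *)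

theory Defs
  imports "HOL-Analysis.Analysis" "HOL-Probability.Probability"
begin

primrec matpow :: "real^'n^'n \<Rightarrow> nat \<Rightarrow> real^'n^'n" where
  "matpow A 0 = mat 1"
| "matpow A (Suc m) = A ** matpow A m"

(* The bijection ix from {0..K} names the coordinates of the parameter vector, so that
   \<theta> $ ix k is the coefficient of the k-th power. *)
definition poly_mat :: "nat \<Rightarrow> (nat \<Rightarrow> 'k::finite) \<Rightarrow> real^'k \<Rightarrow> real^'n^'n \<Rightarrow> real^'n^'n" where
  "poly_mat K ix \<theta> A = (\<Sum>k=0..K. (\<theta> $ ix k) *\<^sub>R matpow A k)"

definition partial :: "'k::finite \<Rightarrow> (real^'k \<Rightarrow> real) \<Rightarrow> real^'k \<Rightarrow> real" where
  "partial a f \<theta> = deriv (\<lambda>s. f (\<theta> + s *\<^sub>R axis a 1)) 0"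

definition C1_on :: "(real^'k::finite) set \<Rightarrow> (real^'k \<Rightarrow> real) \<Rightarrow> bool" where
  "C1_on N f \<longleftrightarrow> (\<exists>g. continuous_on N g \<and> (\<forall>\<theta>\<in>N. (f has_derivative (\<lambda>h. g \<theta> \<bullet> h)) (at \<theta>)))"

(* Only the entries above the diagonal are observed; A (t, i, j) is the edge indicator of the
   pair i < j at time t. Observation times are 0, ..., T, trajectories live in real time. *)
type_synonym 'n graphs = "nat \<times> 'n \<times> 'n \<Rightarrow> bool"
type_synonym ('k, 'n) matrix_path = "real \<Rightarrow> real^'k \<Rightarrow> real^'n^'n"

definition data_law ::
    "nat \<Rightarrow> ('k::finite, 'n::{finite,linorder}) matrix_path \<Rightarrow> real^'k \<Rightarrow> 'n graphs pmf" where
  "data_law T P \<theta> = Pi_pmf {(t, i, j). t \<le> T \<and> i < j} False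
     (\<lambda>(t, i, j). bernoulli_pmf (P (real t) \<theta> $ i $ j))"

definition log_lik ::
    "nat \<Rightarrow> ('k::finite, 'n::{finite,linorder}) matrix_path \<Rightarrow> 'n graphs \<Rightarrow> real^'k \<Rightarrow> real" where
  "log_lik T P A \<theta> = (\<Sum>t=0..T. \<Sum>(i, j) | i < j.
     of_bool (A (t, i, j)) * ln (P (real t) \<theta> $ i $ j) +
     (1 - of_bool (A (t, i, j))) * ln (1 - P (real t) \<theta> $ i $ j))"

definition fisher_regular ::
    "nat \<Rightarrow> ('k::finite, 'n::{finite,linorder}) matrix_path \<Rightarrow> real^'k \<Rightarrow> bool" where
  "fisher_regular T P \<theta> \<longleftrightarrow>
     (\<forall>a. integrable (measure_pmf (data_law T P \<theta>)) (\<lambda>A. partial a (log_lik T P A) \<theta>)) \<and>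
     (\<forall>a (g :: 'n graphs \<Rightarrow> real).
        ((\<lambda>s. measure_pmf.expectation (data_law T P (\<theta> + s *\<^sub>R axis a 1)) g)
           has_real_derivative
         measure_pmf.expectation (data_law T P \<theta>) (\<lambda>A. g A * partial a (log_lik T P A) \<theta>)) (at 0))"

definition fisher_info ::
    "nat \<Rightarrow> ('k::finite, 'n::{finite,linorder}) matrix_path \<Rightarrow> real^'k \<Rightarrow> real^'k^'k" where
  "fisher_info T P \<theta> = (\<chi> a b. \<Sum>t=0..T. \<Sum>(i, j) | i < j.
     partial a (\<lambda>\<theta>. P (real t) \<theta> $ i $ j) \<theta> * partial b (\<lambda>\<theta>. P (real t) \<theta> $ i $ j) \<theta> *
     (1 / (P (real t) \<theta> $ i $ j * (1 - P (real t) \<theta> $ i $ j))))"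

(* A direction is unidentifiable at \<theta> if some curve leaves \<theta> in that direction without changing
   the law of the data. Curves, not just straight lines, are needed: already for few observation
   times the set of parameters with a given law is in general a curved submanifold. *)
definition unidentifiable_dirs ::
    "nat \<Rightarrow> ('k::finite, 'n::{finite,linorder}) matrix_path \<Rightarrow> real^'k \<Rightarrow> (real^'k) set" where
  "unidentifiable_dirs T P \<theta> = {v. \<exists>c. c 0 = \<theta> \<and> (c has_vector_derivative v) (at 0) \<and>
     (\<forall>\<^sub>F s in nhds 0. data_law T P (c s) = data_law T P \<theta>)}"

definition identifiable_subspace ::
    "nat \<Rightarrow> ('k::finite, 'n::{finite,linorder}) matrix_path \<Rightarrow> real^'k \<Rightarrow> (real^'k) set" where
  "identifiable_subspace T P \<theta> = orthogonal_comp (unidentifiable_dirs T P \<theta>)"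

definition pos_def_on :: "(real^'k::finite) set \<Rightarrow> real^'k^'k \<Rightarrow> bool" where
  "pos_def_on S M \<longleftrightarrow> transpose M = M \<and> (\<forall>v\<in>S. v \<noteq> 0 \<longrightarrow> v \<bullet> (M *v v) > 0)"

definition moore_penrose :: "real^'n^'m \<Rightarrow> real^'m^'n \<Rightarrow> bool" where
  "moore_penrose A B \<longleftrightarrow> A ** B ** A = A \<and> B ** A ** B = B \<and>
     transpose (A ** B) = A ** B \<and> transpose (B ** A) = B ** A"

definition pinv :: "real^'n^'m \<Rightarrow> real^'m^'n" where
  "pinv A = (THE B. moore_penrose A B)"

definition unbiased ::
    "nat \<Rightarrow> ('k::finite, 'n::{finite,linorder}) matrix_path \<Rightarrow> (real^'k) set \<Rightarrow>
     ('n graphs \<Rightarrow> real^'k) \<Rightarrow> bool" where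
  "unbiased T P \<Theta> est \<longleftrightarrow> (\<forall>\<theta>\<in>\<Theta>. measure_pmf.expectation (data_law T P \<theta>) est = \<theta>)"

(* Unbiasedness of the S-components of the estimator while the parameter varies over the slice
   \<theta> + S of the parameter set; for S = UNIV this is ordinary unbiasedness. *)
definition unbiased_along ::
    "nat \<Rightarrow> ('k::finite, 'n::{finite,linorder}) matrix_path \<Rightarrow> (real^'k) set \<Rightarrow>
     (real^'k) set \<Rightarrow> real^'k \<Rightarrow> ('n graphs \<Rightarrow> real^'k) \<Rightarrow> bool" where
  "unbiased_along T P \<Theta> S \<theta> est \<longleftrightarrow> (\<forall>\<theta>'\<in>\<Theta>. \<theta>' - \<theta> \<in> S \<longrightarrow>
     (\<forall>v\<in>S. v \<bullet> measure_pmf.expectation (data_law T P \<theta>') est = v \<bullet> \<theta>'))"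

(* eig_coupling is the C of the Fisher information formula, eig_weight is the W. *)
definition eig_coupling :: "real^'d^('n::{finite,linorder}) \<Rightarrow> real^('n::{finite,linorder})^('n::{finite,linorder}) \<Rightarrow> 'd \<Rightarrow> 'd \<Rightarrow> real" where
  "eig_coupling U Q \<iota> \<gamma> = (\<Sum>(i, j) | i < j.
     U $ i $ \<iota> * U $ j $ \<iota> * U $ i $ \<gamma> * U $ j $ \<gamma> / (Q $ i $ j * (1 - Q $ i $ j)))"

definition eig_weight :: "real^'d^('n::{finite,linorder}) \<Rightarrow> real^('n::{finite,linorder})^('n::{finite,linorder}) \<Rightarrow> 'd \<Rightarrow> real" where
  "eig_weight U Q \<iota> = (\<Sum>(i, j) | i < j.
     (U $ i $ \<iota>)\<^sup>2 * (U $ j $ \<iota>)\<^sup>2 / (Q $ i $ j * (1 - Q $ i $ j)))"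

definition cross_terms ::
    "nat \<Rightarrow> ('k::finite, 'n::{finite,linorder}) matrix_path \<Rightarrow> real^'d^('n::{finite,linorder}) \<Rightarrow>
     (real \<Rightarrow> real^'k \<Rightarrow> real^'d::finite) \<Rightarrow> real^'k \<Rightarrow> 'k \<Rightarrow> real" where
  "cross_terms T P U lam \<theta> a = (\<Sum>t=0..T. \<Sum>(\<iota>, \<gamma>) | \<iota> \<noteq> \<gamma>.
     partial a (\<lambda>\<theta>. lam (real t) \<theta> $ \<iota>) \<theta> * partial a (\<lambda>\<theta>. lam (real t) \<theta> $ \<gamma>) \<theta> *
     eig_coupling U (P (real t) \<theta>) \<iota> \<gamma>)"

end

theory Submission
  imports Defs
begin

text \<open>Each entry of \<open>P\<close> equals \<open>\<Sum>\<^sub>\<iota> U\<^sub>i\<^sub>\<iota> U\<^sub>j\<^sub>\<iota> \<lambda>\<^sub>\<iota>\<close> at all times, because the defect \<open>P u - \<lambda> u\<close> of an initial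
  eigenvector obeys a linear differential inequality and so stays zero by Gronwall; vectors orthogonal to the
  columns of \<open>U\<close> are covered by the constant solution \<open>\<lambda> = 0\<close>.

  Differentiating the expectation of an edge indicator gives its covariance with the score. Since the score is a
  linear combination of centred edge indicators, this yields the information identity without using
  independence. An unidentifiable direction leaves every edge probability stationary and is therefore in the
  kernel of the information matrix, so the identifiable subspace contains its range and positive definiteness
  makes the pseudoinverse the inverse on that subspace. The bounds are Cauchy--Schwarz between the estimator
  and the score in the direction \<open>\<I>\<^sup>+ v\<close>.\<close>

section \<open>Pseudoinverses and projections\<close>

text \<open>Both inverses give the same projections: since \<open>A ** B\<close> and
  \<open>A ** C\<close> are symmetric, transposing \<open>A ** C ** A ** B\<close> reverses their
  order, so each absorbs the other; likewise for \<open>B ** A\<close> and \<open>C ** A\<close>.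
  Then \<open>B = B ** A ** B = C ** A ** C = C\<close>.\<close>

lemma moore_penrose_unique:
  assumes "moore_penrose A B" "moore_penrose A C"
  shows "B = C"
proof -
  have B: "A ** B ** A = A" "B ** A ** B = B" "transpose (A ** B) = A ** B" "transpose (B ** A) = B ** A"
    and C: "A ** C ** A = A" "C ** A ** C = C" "transpose (A ** C) = A ** C" "transpose (C ** A) = C ** A"
    using assms by (auto simp: moore_penrose_def)
  have "A ** B = transpose ((A ** C ** A) ** B)"
    using B(3) C(1) by simp
  also have "\<dots> = transpose (A ** B) ** transpose (A ** C)"
    by (simp add: matrix_mul_assoc flip: matrix_transpose_mul)
  also have "\<dots> = (A ** B ** A) ** C"
    by (simp only: B(3,4) C(3,4) matrix_mul_assoc)
  finally have AB: "A ** B = A ** C"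
    by (simp add: B)
  have "B ** A = transpose (B ** (A ** C ** A))"
    using B(4) C(1) by simp
  also have "\<dots> = transpose (C ** A) ** transpose (B ** A)"
    by (simp add: matrix_mul_assoc flip: matrix_transpose_mul)
  also have "\<dots> = C ** (A ** B ** A)"
    by (simp only: B(3,4) C(3,4) matrix_mul_assoc)
  finally have BA: "B ** A = C ** A"
    by (simp only: B)
  have "B = B ** (A ** B)"
    by (simp add: B matrix_mul_assoc)
  also have "\<dots> = C ** A ** C"
    by (simp add: AB matrix_mul_assoc BA)
  finally show ?thesis
    by (simp add: C)
qed

lemma pinv_eq: "moore_penrose A B \<Longrightarrow> pinv A = B"
  unfolding pinv_def by (blast intro: moore_penrose_unique)

lemma pinv_invertible:
  fixes A :: "real^'n^'n"
  assumes "invertible A"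
  shows "pinv A = matrix_inv A"
proof (rule pinv_eq)
  have "A ** matrix_inv A = mat 1 \<and> matrix_inv A ** A = mat 1"
    using assms unfolding invertible_def matrix_inv_def by (rule someI_ex)
  then show "moore_penrose A (matrix_inv A)"
    by (simp add: moore_penrose_def transpose_mat)
qed

section \<open>Transposes and linearity of the matrix product\<close>

lemma inner_matrix_transpose: "(x::real^'n) \<bullet> (A *v y) = (transpose A *v x) \<bullet> y"
  by (simp add: dot_lmul_matrix)

lemma inner_matrix_symmetric:
  fixes A :: "real^'n^'n"
  shows "transpose A = A \<Longrightarrow> x \<bullet> (A *v y) = (A *v x) \<bullet> y"
  using inner_matrix_transpose[of x A y] by (simp del: transpose_matrix_vector)

lemma diff_matrix_mult: "((A::real^'n^'m) - B) ** C = A ** C - B ** C"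
  by (simp add: matrix_matrix_mult_def vec_eq_iff sum_subtractf left_diff_distrib)

lemma matrix_mult_diff: "(C::real^'n^'m) ** (A - B) = C ** A - C ** B"
  by (simp add: matrix_matrix_mult_def vec_eq_iff sum_subtractf right_diff_distrib)

lemma add_matrix_mult: "((A::real^'n^'m) + B) ** C = A ** C + B ** C"
  by (simp add: matrix_matrix_mult_def vec_eq_iff sum.distrib distrib_right)

lemma transpose_diff: "transpose ((A::real^'n^'m) - B) = transpose A - transpose B"
  by (simp add: transpose_def vec_eq_iff)

lemma transpose_add: "transpose ((A::real^'n^'m) + B) = transpose A + transpose B"
  by (simp add: transpose_def vec_eq_iff)

text \<open>The orthogonal projector onto \<open>S\<close>, built as the sum of the outer products
  of an orthonormal basis with itself.\<close>

lemma orthogonal_projection_matrix: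
  fixes S :: "(real^'n) set"
  assumes "subspace S"
  obtains R where "transpose R = R" "\<And>x. R *v x \<in> S" "\<And>x. x \<in> S \<Longrightarrow> R *v x = x"
proof -
  obtain B where B: "B \<subseteq> S" "pairwise orthogonal B" "\<And>x. x \<in> B \<Longrightarrow> norm x = 1"
      "independent B" "span B = S"
    by (metis orthonormal_basis_subspace [OF assms])
  have fin: "finite B"
    by (rule independent_imp_finite[OF B(4)])
  define R :: "real^'n^'n" where "R = (\<chi> i j. \<Sum>b\<in>B. b $ i * b $ j)"
  have R: "R *v x = (\<Sum>b\<in>B. (b \<bullet> x) *\<^sub>R b)" for x
    unfolding R_def
    by (simp add: vec_eq_iff matrix_vector_mult_def inner_vec_def sum_distrib_right sum_distrib_left
        mult_ac) (subst sum.swap, simp)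
  show thesis
  proof
    show "transpose R = R"
      by (simp add: R_def transpose_def vec_eq_iff mult_ac)
    show "R *v x \<in> S" for x
      unfolding R using B(1) assms by (intro subspace_sum subspace_scale) auto
    fix x assume "x \<in> S"
    then have "x \<in> span B" using B(5) by simp
    then obtain u where u: "x = (\<Sum>b\<in>B. u b *\<^sub>R b)"
      using span_finite[OF fin] by auto
    have "b \<bullet> x = u b" if "b \<in> B" for b
    proof -
      have "b \<bullet> x = (\<Sum>c\<in>B. u c * (b \<bullet> c))"
        by (simp add: u inner_sum_right)
      also have "\<dots> = (\<Sum>c\<in>B. if c = b then u b else 0)"
        using B(2,3) that
        by (intro sum.cong refl) (auto simp: pairwise_def orthogonal_def simp flip: power2_norm_eq_inner)
      finally show ?thesis using fin that by simp
    qed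
    then show "R *v x = x"
      using R u by simp
  qed
qed

text \<open>Symmetry of \<open>R\<close> makes the residual \<open>x - R *v x\<close> orthogonal to
  \<open>S\<close>, so both claims are instances of Pythagoras. This translates
  \<open>closest_point\<close> into linear algebra.\<close>

lemma closest_point_projection:
  fixes S :: "(real^'n) set"
  assumes S: "subspace S" and R: "transpose R = R" "\<And>x. R *v x \<in> S" "\<And>x. x \<in> S \<Longrightarrow> R *v x = x"
  shows "closest_point S x = R *v x" "norm (R *v x) \<le> norm x"
proof -
  have orth: "(x - R *v x) \<bullet> y = 0" if "y \<in> S" for y
    using R(3)[OF that] inner_matrix_symmetric[OF R(1), of x y] by (simp add: inner_diff_left)
  have "norm (x - R *v x) \<le> norm (x - y)" if "y \<in> S" for y
  proof -
    have "orthogonal (x - R *v x) (R *v x - y)"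
      unfolding orthogonal_def by (rule orth) (use R(2) that S in \<open>blast intro: subspace_diff\<close>)
    then have "(norm (x - y))\<^sup>2 = (norm (x - R *v x))\<^sup>2 + (norm (R *v x - y))\<^sup>2"
      using norm_add_Pythagorean[of "x - R *v x" "R *v x - y"] by simp
    then have "(norm (x - R *v x))\<^sup>2 \<le> (norm (x - y))\<^sup>2"
      by simp
    then show ?thesis
      by (rule power2_le_imp_le) simp
  qed
  then show "closest_point S x = R *v x"
    using S R(2) by (intro closest_point_unique[symmetric] subspace_imp_convex closed_subspace) (auto simp: dist_norm)
  have "orthogonal (x - R *v x) (R *v x)"
    unfolding orthogonal_def by (rule orth) (rule R(2))
  then have "(norm x)\<^sup>2 = (norm (x - R *v x))\<^sup>2 + (norm (R *v x))\<^sup>2"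
    using norm_add_Pythagorean[of "x - R *v x" "R *v x"] by simp
  then have "(norm (R *v x))\<^sup>2 \<le> (norm x)\<^sup>2"
    by simp
  then show "norm (R *v x) \<le> norm x"
    by (rule power2_le_imp_le) simp
qed

text \<open>With \<open>Q = 1 - R\<close>, the matrix \<open>M + Q\<close> is invertible and \<open>(M + Q)\<inverse> - Q\<close> is the pseudoinverse.\<close>
lemma pinv_on_subspace:
  fixes M R :: "real^'n^'n"
  assumes M: "pos_def_on S M"
    and R: "transpose R = R" "\<And>x. R *v x \<in> S" "\<And>x. x \<in> S \<Longrightarrow> R *v x = x"
    and MR: "M ** R = M"
  shows "transpose (pinv M) = pinv M" "M ** pinv M = R" "pinv M ** R = pinv M" "R ** pinv M = pinv M"
    "pinv M ** M ** pinv M = pinv M"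
proof -
  have tM: "transpose M = M" using M by (simp add: pos_def_on_def)
  have RM: "R ** M = M"
    by (metis MR R(1) matrix_transpose_mul tM)
  have RR: "R ** R = R"
    by (rule matrix_eq[THEN iffD2]) (simp add: R flip: matrix_vector_mul_assoc)
  define Q where "Q = mat 1 - R"
  define N where "N = M + Q"
  have tQ: "transpose Q = Q" and tN: "transpose N = N"
    by (simp_all add: Q_def N_def transpose_diff transpose_add transpose_mat R tM)
  have QQ: "Q ** Q = Q" and MQ: "M ** Q = 0" and QM: "Q ** M = 0"
    by (simp_all add: Q_def diff_matrix_mult matrix_mult_diff RR MR RM)
  \<comment> \<open>The quadratic form of \<open>N\<close> at \<open>x\<close> is that of
    \<open>M\<close> at \<open>R *v x\<close> plus the squared norm of \<open>Q *v x\<close>. Both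
    summands are nonnegative, so on the kernel of \<open>N\<close> both parts of \<open>x\<close>
    vanish.\<close>
  have "N *v x = 0 \<Longrightarrow> x = 0" for x
  proof -
    assume 0: "N *v x = 0"
    have "x \<bullet> (M *v x) = (R *v x) \<bullet> (M *v (R *v x))"
      by (metis MR RM R(1) inner_matrix_symmetric matrix_vector_mul_assoc)
    moreover have "x \<bullet> (Q *v x) = (Q *v x) \<bullet> (Q *v x)"
      by (metis QQ tQ inner_matrix_symmetric matrix_vector_mul_assoc)
    moreover have "x \<bullet> (M *v x) + x \<bullet> (Q *v x) = 0"
      using 0 by (simp add: N_def matrix_vector_mult_add_rdistrib flip: inner_add_right)
    moreover have "(R *v x) \<bullet> (M *v (R *v x)) > 0" if "R *v x \<noteq> 0"
      using M R(2) that by (simp add: pos_def_on_def)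
    moreover have "(Q *v x) \<bullet> (Q *v x) \<ge> 0" by simp
    ultimately have "R *v x = 0" "Q *v x = 0"
      by (smt (verit) inner_zero_left inner_eq_zero_iff)+
    then show "x = 0"
      by (simp add: Q_def matrix_vector_mult_diff_rdistrib)
  qed
  then have "\<exists>L. L ** N = mat 1"
    unfolding matrix_left_invertible_ker by blast
  then obtain L where L: "L ** N = mat 1" "N ** L = mat 1"
    using matrix_left_right_inverse by blast
  have tL: "transpose L = L"
    by (metis L matrix_mul_assoc matrix_mul_lid matrix_mul_rid matrix_transpose_mul tN transpose_mat)
  have NQ: "N ** Q = Q" "Q ** N = Q"
    by (simp_all add: N_def matrix_add_ldistrib add_matrix_mult MQ QM QQ)
  have LQ: "L ** Q = Q" "Q ** L = Q"
    by (metis L NQ matrix_mul_assoc matrix_mul_lid matrix_mul_rid)+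
  \<comment> \<open>\<open>N\<close> fixes the range of \<open>Q\<close>, hence so does its inverse
    \<open>L\<close>. Subtracting \<open>Q\<close> leaves the inverse of \<open>M\<close> on
    \<open>S\<close> and zero on the orthogonal complement.\<close>
  define B where "B = L - Q"
  have MB: "M ** B = R" "B ** M = R"
  proof -
    have "M = N - Q" by (simp add: N_def)
    then show "M ** B = R" "B ** M = R"
      by (simp_all add: B_def diff_matrix_mult matrix_mult_diff L LQ NQ QQ) (simp_all add: Q_def)
  qed
  have BR: "B ** R = B" "R ** B = B"
  proof -
    have "R = mat 1 - Q" by (simp add: Q_def)
    then show "B ** R = B" "R ** B = B"
      by (simp_all add: B_def diff_matrix_mult matrix_mult_diff LQ QQ)
  qed
  have "moore_penrose M B"
    by (simp add: moore_penrose_def MB BR RM R)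
  then have "pinv M = B" by (rule pinv_eq)
  then show "transpose (pinv M) = pinv M" "M ** pinv M = R" "pinv M ** R = pinv M" "R ** pinv M = pinv M"
    "pinv M ** M ** pinv M = pinv M"
    by (simp_all add: MB BR) (simp add: B_def transpose_diff tL tQ)
qed

text \<open>The usual discriminant argument: the form at \<open>x + s *\<^sub>R y\<close> is a
  nonnegative quadratic in \<open>s\<close>. As the form may be degenerate, a vanishing leading
  coefficient is treated separately.\<close>

lemma semidefinite_Cauchy_Schwarz:
  fixes M :: "real^'n^'n"
  assumes "transpose M = M" "\<And>x. x \<bullet> (M *v x) \<ge> 0"
  shows "(x \<bullet> (M *v y))\<^sup>2 \<le> (x \<bullet> (M *v x)) * (y \<bullet> (M *v y))"
proof -
  let ?a = "y \<bullet> (M *v y)" and ?b = "x \<bullet> (M *v y)" and ?c = "x \<bullet> (M *v x)"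
  have sym: "y \<bullet> (M *v x) = ?b"
    by (metis inner_matrix_symmetric[OF assms(1)] inner_commute)
  have q: "0 \<le> ?c + 2 * s * ?b + s\<^sup>2 * ?a" for s
    using assms(2)[of "x + s *\<^sub>R y"]
    by (simp add: matrix_vector_right_distrib matrix_vector_mult_scaleR inner_add_left inner_add_right sym
        power2_eq_square algebra_simps)
  show ?thesis
  proof (cases "?a = 0")
    case True
    have "?b = 0"
    proof (rule ccontr)
      assume "?b \<noteq> 0"
      \<comment> \<open>With no quadratic term, the expression is affine in \<open>s\<close>; this
        choice of \<open>s\<close> makes it equal to -1.\<close>
      then have "2 * (- (?c + 1) / (2 * ?b)) * ?b = - (?c + 1)"
        by simp
      then show False
        using q[of "- (?c + 1) / (2 * ?b)"] unfolding True by linarith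
    qed
    then show ?thesis using True by simp
  next
    case False
    then have "?a > 0" using assms(2)[of y] by simp
    \<comment> \<open>\<open>- ?b / ?a\<close> minimises the quadratic; the factor \<open>?a\<close>
      clears the denominator.\<close>
    have "0 \<le> ?a * (?c + 2 * (- ?b / ?a) * ?b + (- ?b / ?a)\<^sup>2 * ?a)"
      using q[of "- ?b / ?a"] \<open>?a > 0\<close> by (intro mult_nonneg_nonneg) auto
    also have "\<dots> = ?c * ?a - ?b\<^sup>2"
      using False by (simp add: field_simps power2_eq_square)
    finally show ?thesis by simp
  qed
qed

section \<open>Stationarity of eigenvectors\<close>

text \<open>The factor \<open>exp (- 2 * C * s)\<close> absorbs the growth rate, so the weighted
  squared norm \<open>g\<close> has nonpositive derivative. It starts at zero, and the mean value
  theorem keeps it from becoming positive.\<close>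

lemma gronwall_zero:
  fixes w :: "real \<Rightarrow> 'a::real_inner"
  assumes der: "\<And>t. t \<in> {0..T} \<Longrightarrow> (w has_vector_derivative w' t) (at t within {0..T})"
    and bound: "\<And>t. t \<in> {0..T} \<Longrightarrow> norm (w' t) \<le> C * norm (w t)"
    and init: "w 0 = 0" and t: "t \<in> {0..T}"
  shows "w t = 0"
proof -
  define g where "g s = exp (- 2 * C * s) * (w s \<bullet> w s)" for s
  define g' where "g' s = exp (- 2 * C * s) * (2 * (w s \<bullet> w' s) - 2 * C * (w s \<bullet> w s))" for s
  have g: "(g has_derivative (\<lambda>h. h * g' s)) (at s within {0..t})" if "0 \<le> s" "s \<le> t" for s
  proof -
    have w: "(w has_derivative (\<lambda>h. h *\<^sub>R w' s)) (at s within {0..t})"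
      using der[of s] that t unfolding has_vector_derivative_def
      by (auto elim!: has_derivative_subset)
    show ?thesis unfolding g_def g'_def
      by (rule has_derivative_eq_rhs, (rule derivative_intros w)+)
        (auto simp: fun_eq_iff algebra_simps inner_commute)
  qed
  obtain s where s: "s \<in> {0..t}" "g t - g 0 = (t - 0) * g' s"
    using mvt_very_simple[of 0 t g "\<lambda>s h. h * g' s", OF _ g] t by auto
  have "w s \<bullet> w' s \<le> norm (w s) * norm (w' s)"
    by (rule norm_cauchy_schwarz)
  also have "\<dots> \<le> norm (w s) * (C * norm (w s))"
    using s t by (intro mult_left_mono bound) auto
  finally have "w s \<bullet> w' s \<le> C * (w s \<bullet> w s)"
    by (simp add: power2_eq_square mult_ac flip: power2_norm_eq_inner)
  then have "g' s \<le> 0"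
    unfolding g'_def by (intro mult_nonneg_nonpos) auto
  then have "(t - 0) * g' s \<le> 0"
    using t by (intro mult_nonneg_nonpos) auto
  moreover have "g 0 = 0" by (simp add: g_def init)
  ultimately have "exp (- 2 * C * t) * (w t \<bullet> w t) \<le> 0"
    using s(2) by (simp add: g_def)
  then have "w t \<bullet> w t \<le> 0"
    by (simp add: mult_le_0_iff)
  then show ?thesis by (simp add: not_less[symmetric] inner_gt_zero_iff)
qed

section \<open>Powers and polynomials of a matrix\<close>

lemma matrix_vector_mult_sum_left: "(\<Sum>k\<in>I. M k) *v (x::real^'n) = (\<Sum>k\<in>I. M k *v x)"
  by (induction I rule: infinite_finite_induct) (simp_all add: matrix_vector_mult_add_rdistrib)

lemma matpow_commute: "matpow A m ** A = A ** matpow A m"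
  by (induction m) (simp_all flip: matrix_mul_assoc)

lemma transpose_matpow: "transpose A = A \<Longrightarrow> transpose (matpow A m) = matpow A m"
  by (induction m) (simp_all add: transpose_mat matrix_transpose_mul matpow_commute)

lemma transpose_poly_mat:
  assumes "transpose A = A"
  shows "transpose (poly_mat K ix c A) = poly_mat K ix c A"
  unfolding poly_mat_def
  using arg_cong[OF transpose_matpow[OF assms], of "\<lambda>M. M $ _ $ _"]
  by (simp add: vec_eq_iff transpose_def)

lemma norm_matpow_mult:
  assumes "\<And>w. norm (A *v w) \<le> M * norm w" "0 \<le> M"
  shows "norm (matpow A m *v w) \<le> M ^ m * norm w"
proof (induction m)
  case (Suc m)
  have "norm (matpow A (Suc m) *v w) \<le> M * norm (matpow A m *v w)"
    using assms(1)[of "matpow A m *v w"] by (simp add: matrix_vector_mul_assoc)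
  also have "\<dots> \<le> M * (M ^ m * norm w)"
    using Suc assms(2) by (rule mult_left_mono)
  finally show ?case by simp
qed simp

text \<open>Telescoping: each further power applies \<open>A\<close> to the old defect and adds
  \<open>l ^ m\<close> times the basic one, which gives \<open>m\<close> terms in total. The
  condition \<open>1 \<le> M\<close> allows \<open>M ^ m\<close> as a common bound for them.\<close>

lemma norm_matpow_eigen_defect:
  assumes A: "\<And>w. norm (A *v w) \<le> M * norm w" and M: "1 \<le> M" "\<bar>l\<bar> \<le> M"
  shows "norm (matpow A m *v u - l ^ m *\<^sub>R u) \<le> m * M ^ m * norm (A *v u - l *\<^sub>R u)"
proof (induction m)
  case (Suc m)
  let ?d = "norm (A *v u - l *\<^sub>R u)"
  have "matpow A (Suc m) *v u - l ^ Suc m *\<^sub>R u =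
      A *v (matpow A m *v u - l ^ m *\<^sub>R u) + l ^ m *\<^sub>R (A *v u - l *\<^sub>R u)"
    by (simp add: matrix_vector_mul_assoc matrix_vector_mult_diff_distrib matrix_vector_mult_scaleR
        scaleR_diff_right mult.commute)
  then have "norm (matpow A (Suc m) *v u - l ^ Suc m *\<^sub>R u) \<le>
      norm (A *v (matpow A m *v u - l ^ m *\<^sub>R u)) + \<bar>l\<bar> ^ m * ?d"
    using norm_triangle_ineq by (metis norm_scaleR power_abs)
  also have "\<dots> \<le> M * (m * M ^ m * ?d) + M ^ Suc m * ?d"
  proof (intro add_mono mult_right_mono)
    show "norm (A *v (matpow A m *v u - l ^ m *\<^sub>R u)) \<le> M * (m * M ^ m * ?d)"
      using A[of "matpow A m *v u - l ^ m *\<^sub>R u"] Suc M(1)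
      by (smt (verit, best) mult_left_mono)
    have "\<bar>l\<bar> ^ m \<le> M ^ m" using M by (intro power_mono) auto
    also have "\<dots> \<le> M ^ Suc m" using M by (intro power_increasing) auto
    finally show "\<bar>l\<bar> ^ m \<le> M ^ Suc m" .
  qed simp
  also have "\<dots> = Suc m * M ^ Suc m * ?d"
    by (simp add: algebra_simps)
  finally show ?case .
qed simp

text \<open>Together with the next two facts this gives the product rule for matrix-valued paths
  without passing to entries.\<close>

lemma bounded_bilinear_matrix_mult:
  "bounded_bilinear ((**) :: real^'n^'m \<Rightarrow> real^'p^'n \<Rightarrow> real^'p^'m)"
  unfolding bilinear_conv_bounded_bilinear[symmetric] bilinear_def
  by (auto intro!: linearI simp: vec_eq_iff matrix_matrix_mult_def
      sum.distrib sum_distrib_left distrib_left distrib_right mult_ac)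

lemma bounded_bilinear_matrix_vector_mult:
  "bounded_bilinear ((*v) :: real^'n^'m \<Rightarrow> real^'n \<Rightarrow> real^'m)"
  unfolding bilinear_conv_bounded_bilinear[symmetric] bilinear_def
  by (auto intro!: linearI simp: matrix_vector_mult_add_rdistrib matrix_vector_right_distrib
      matrix_vector_mult_scaleR scaleR_matrix_vector_assoc)

lemma bounded_linear_transpose: "bounded_linear (transpose :: real^'n^'m \<Rightarrow> real^'m^'n)"
  unfolding linear_conv_bounded_linear[symmetric]
  by (auto intro!: linearI simp: transpose_add transpose_scalar)

text \<open>The defect \<open>v = P u - l u\<close> satisfies \<open>\<bar>v'\<bar> \<le> C \<bar>v\<bar>\<close>, because \<open>P' = P A + A P\<close> with
  \<open>A\<close> a polynomial in \<open>P\<close> and each \<open>P\<^sup>m u - l\<^sup>m u\<close> is divisible by \<open>v\<close>.\<close>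
lemma eigenvector_stationary:
  fixes X :: "real \<Rightarrow> real^'d^'n" and c :: "real^'k::finite" and l :: "real \<Rightarrow> real"
  defines "P \<equiv> \<lambda>t. X t ** transpose (X t)"
  assumes X: "\<And>t. t \<in> {0..T} \<Longrightarrow>
      (X has_vector_derivative (poly_mat K ix c (P t) ** X t)) (at t within {0..T})"
    and l: "\<And>t. t \<in> {0..T} \<Longrightarrow>
      (l has_real_derivative 2 * (\<Sum>k=0..K. c $ ix k * l t ^ (k + 1))) (at t within {0..T})"
    and init: "P 0 *v u = l 0 *\<^sub>R u" and t: "t \<in> {0..T}"
  shows "P t *v u = l t *\<^sub>R u"
proof -
  define A where "A t = poly_mat K ix c (P t)" for t
  define p where "p t = (\<Sum>k=0..K. c $ ix k * l t ^ k)" for t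
  define v where "v t = P t *v u - l t *\<^sub>R u" for t
  \<comment> \<open>The derivative of \<open>v\<close>, rearranged by writing
    \<open>A t *v u\<close> as \<open>p t *\<^sub>R u\<close> plus its defect and
    \<open>P t *v u\<close> as \<open>l t *\<^sub>R u + v t\<close>. The terms in
    \<open>p t * l t\<close> cancel, and each remaining summand contains a defect.\<close>
  define v' where "v' t = P t *v (A t *v u - p t *\<^sub>R u) + p t *\<^sub>R v t
      + (A t *v v t + l t *\<^sub>R (A t *v u - p t *\<^sub>R u))" for t
  interpret mm: bounded_bilinear "(**) :: real^'d^'n \<Rightarrow> real^'n^'d \<Rightarrow> real^'n^'n"
    by (rule bounded_bilinear_matrix_mult)
  interpret mv: bounded_bilinear "(*v) :: real^'n^'n \<Rightarrow> real^'n \<Rightarrow> real^'n"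
    by (rule bounded_bilinear_matrix_vector_mult)
  have P_sym: "transpose (P t) = P t" for t
    by (simp add: P_def matrix_transpose_mul)
  have A_sym: "transpose (A t) = A t" for t
    unfolding A_def by (rule transpose_poly_mat[OF P_sym])
  have P': "(P has_vector_derivative (P t ** A t + A t ** P t)) (at t within {0..T})"
    if "t \<in> {0..T}" for t
  proof -
    have "((\<lambda>s. X s ** transpose (X s)) has_vector_derivative
        (X t ** transpose (A t ** X t) + (A t ** X t) ** transpose (X t))) (at t within {0..T})"
      unfolding A_def
      by (intro mm.has_vector_derivative bounded_linear.has_vector_derivative[OF bounded_linear_transpose] X that)
    then show ?thesis
      by (simp add: P_def[abs_def] matrix_transpose_mul A_sym[unfolded P_def] matrix_mul_assoc)
  qed
  have v': "(v has_vector_derivative v' t) (at t within {0..T})" if "t \<in> {0..T}" for t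
  proof -
    have l': "(l has_real_derivative (p t * l t + p t * l t)) (at t within {0..T})"
      using l[OF that] unfolding mult_2[symmetric] by (simp add: p_def sum_distrib_left sum_distrib_right mult_ac)
    have "(v has_vector_derivative ((P t ** A t + A t ** P t) *v u - (p t * l t + p t * l t) *\<^sub>R u))
        (at t within {0..T})"
      unfolding v_def[abs_def]
      by (rule derivative_eq_intros mv.has_vector_derivative P' that l' refl)+ simp
    moreover have "(P t ** A t + A t ** P t) *v u - (p t * l t + p t * l t) *\<^sub>R u = v' t"
      unfolding v'_def v_def
      by (simp add: matrix_vector_mul_assoc[symmetric] matrix_vector_mult_add_rdistrib
          matrix_vector_mult_diff_distrib matrix_vector_mult_scaleR scaleR_add_left scaleR_diff_right mult.commute[of "l t"])
        (simp add: vec_eq_iff)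
    ultimately show ?thesis by simp
  qed
  \<comment> \<open>A single constant for the whole time interval, by compactness. It is taken at
    least 1 because the estimate for powers asks for that.\<close>
  obtain M where M: "1 \<le> M" "\<And>t w. t \<in> {0..T} \<Longrightarrow> norm (P t *v w) \<le> M * norm w"
      "\<And>t. t \<in> {0..T} \<Longrightarrow> \<bar>l t\<bar> \<le> M"
  proof -
    have "continuous_on {0..T} P"
      using has_vector_derivative_continuous[OF P'] by (simp add: continuous_on_eq_continuous_within)
    then have "bounded (P ` {0..T})"
      by (intro compact_imp_bounded compact_continuous_image) auto
    then obtain B1 where B1: "\<And>t. t \<in> {0..T} \<Longrightarrow> norm (P t) \<le> B1"
      unfolding bounded_iff by blast
    have "continuous_on {0..T} l"
      using DERIV_continuous[OF l] by (simp add: continuous_on_eq_continuous_within)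
    then have "bounded (l ` {0..T})"
      by (intro compact_imp_bounded compact_continuous_image) auto
    then obtain B2 where B2: "\<And>t. t \<in> {0..T} \<Longrightarrow> \<bar>l t\<bar> \<le> B2"
      unfolding bounded_iff real_norm_def by blast
    obtain C where C: "0 \<le> C" "\<And>a w. norm (a *v w) \<le> norm (a::real^'n^'n) * norm (w::real^'n) * C"
      using mv.nonneg_bounded by blast
    show thesis
    proof
      show "1 \<le> max 1 (max (B1 * C) B2)" by simp
      show "\<bar>l t\<bar> \<le> max 1 (max (B1 * C) B2)" if "t \<in> {0..T}" for t
        using B2[OF that] by simp
      show "norm (P t *v w) \<le> max 1 (max (B1 * C) B2) * norm w" if "t \<in> {0..T}" for t w
      proof -
        have "norm (P t *v w) \<le> norm (P t) * C * norm w"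
          using C(2)[of "P t" w] by (simp add: mult_ac)
        also have "\<dots> \<le> (B1 * C) * norm w"
          using B1[OF that] C(1) by (intro mult_right_mono) auto
        also have "\<dots> \<le> max 1 (max (B1 * C) B2) * norm w"
          by (intro mult_right_mono) auto
        finally show ?thesis .
      qed
    qed
  qed
  \<comment> \<open>\<open>C1\<close> controls the defect of the polynomial \<open>A t\<close>
    relative to that of \<open>P t\<close>; \<open>C2\<close> bounds both \<open>A t\<close> as an
    operator and the scalar \<open>p t\<close>.\<close>
  define C1 where "C1 = (\<Sum>k=0..K. \<bar>c $ ix k\<bar> * (k * M ^ k))"
  define C2 where "C2 = (\<Sum>k=0..K. \<bar>c $ ix k\<bar> * M ^ k)"
  have A_mult: "A t *v w = (\<Sum>k=0..K. c $ ix k *\<^sub>R (matpow (P t) k *v w))" for t w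
    by (simp add: A_def poly_mat_def matrix_vector_mult_sum_left scaleR_matrix_vector_assoc)
  have bound: "norm (v' t) \<le> (2 * M * C1 + 2 * C2) * norm (v t)" if t: "t \<in> {0..T}" for t
  proof -
    have Au: "norm (A t *v u - p t *\<^sub>R u) \<le> C1 * norm (v t)"
    proof -
      have "A t *v u - p t *\<^sub>R u = (\<Sum>k=0..K. c $ ix k *\<^sub>R (matpow (P t) k *v u - l t ^ k *\<^sub>R u))"
        by (simp add: A_mult p_def scaleR_diff_right sum_subtractf scaleR_sum_left)
      also have "norm \<dots> \<le> (\<Sum>k=0..K. \<bar>c $ ix k\<bar> * (k * M ^ k * norm (v t)))"
        unfolding v_def
        by (rule sum_norm_le)
          (auto intro!: mult_left_mono norm_matpow_eigen_defect M t)
      finally show ?thesis by (simp add: C1_def sum_distrib_left sum_distrib_right mult_ac)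
    qed
    have Av: "norm (A t *v v t) \<le> C2 * norm (v t)"
    proof -
      have "norm (A t *v v t) \<le> (\<Sum>k=0..K. \<bar>c $ ix k\<bar> * (M ^ k * norm (v t)))"
        unfolding A_mult using M(1)
        by (intro sum_norm_le) (auto intro!: mult_left_mono norm_matpow_mult M t)
      then show ?thesis by (simp add: C2_def sum_distrib_left sum_distrib_right mult_ac)
    qed
    have p: "\<bar>p t\<bar> \<le> C2"
      unfolding p_def C2_def
      by (rule sum_norm_le[where 'a=real, unfolded real_norm_def])
        (auto simp: abs_mult power_abs intro!: mult_left_mono power_mono M t)
    have "norm (v' t) \<le> norm (P t *v (A t *v u - p t *\<^sub>R u)) + norm (p t *\<^sub>R v t)
        + (norm (A t *v v t) + norm (l t *\<^sub>R (A t *v u - p t *\<^sub>R u)))"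
      unfolding v'_def by (intro norm_triangle_mono order_refl)
    also have "\<dots> \<le> M * (C1 * norm (v t)) + C2 * norm (v t) + (C2 * norm (v t) + M * (C1 * norm (v t)))"
    proof (intro add_mono)
      show "norm (P t *v (A t *v u - p t *\<^sub>R u)) \<le> M * (C1 * norm (v t))"
        using M(1) by (intro order_trans[OF M(2)[OF t]] mult_left_mono Au) auto
      show "norm (p t *\<^sub>R v t) \<le> C2 * norm (v t)"
        using p by (auto intro: mult_right_mono)
      show "norm (l t *\<^sub>R (A t *v u - p t *\<^sub>R u)) \<le> M * (C1 * norm (v t))"
        using M(1) M(3)[OF t] Au by (auto intro!: mult_mono)
    qed (rule Av)
    also have "\<dots> = (2 * M * C1 + 2 * C2) * norm (v t)"
      by (simp add: algebra_simps)
    finally show ?thesis .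
  qed
  have "v t = 0"
    by (rule gronwall_zero[OF v' bound _ t]) (auto simp: v_def init)
  then show ?thesis by (simp add: v_def)
qed

text \<open>Every \<open>x\<close> is its projection \<open>U *v (transpose U *v x)\<close> plus a
  remainder that \<open>transpose U\<close>, hence also \<open>P\<close>, sends to zero. On the
  projection \<open>P\<close> acts by the eigenvalues, and \<open>x = axis j 1\<close> reads off
  column \<open>j\<close>.\<close>

lemma spectral_decomposition:
  fixes P :: "real^'n^'n" and U :: "real^'d^'n" and l :: "real^'d"
  assumes "\<And>i. P *v column i U = l $ i *\<^sub>R column i U"
    and "\<And>x. transpose U *v x = 0 \<Longrightarrow> P *v x = 0" and "transpose U ** U = mat 1"
  shows "P $ i $ j = (\<Sum>k\<in>UNIV. U $ i $ k * U $ j $ k * l $ k)"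
proof -
  have "P *v x = (\<Sum>k\<in>UNIV. (transpose U *v x) $ k *\<^sub>R (l $ k *\<^sub>R column k U))" for x
  proof -
    have "transpose U *v (x - U *v (transpose U *v x)) = 0"
      by (simp del: transpose_matrix_vector
          add: matrix_vector_mult_diff_distrib matrix_vector_mul_assoc matrix_mul_assoc assms(3))
    then have "P *v x = P *v (U *v (transpose U *v x))"
      using assms(2) by (metis matrix_vector_mult_diff_distrib right_minus_eq)
    also have "U *v (transpose U *v x) = (\<Sum>k\<in>UNIV. (transpose U *v x) $ k *\<^sub>R column k U)"
      by (simp add: matrix_mult_sum scalar_mult_eq_scaleR)
    also have "P *v \<dots> = (\<Sum>k\<in>UNIV. (transpose U *v x) $ k *\<^sub>R (P *v column k U))"
      by (simp add: linear_sum[OF matrix_vector_mul_linear] matrix_vector_mult_scaleR del: transpose_matrix_vector)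
    finally show ?thesis by (simp only: assms(1))
  qed
  from this[of "axis j 1"] have "(P *v axis j 1) $ i = (\<Sum>k\<in>UNIV. U $ j $ k * (l $ k * U $ i $ k))"
    by (simp add: column_def matrix_vector_mult_basis transpose_def mult_ac del: transpose_matrix_vector)
  then show ?thesis
    by (simp add: matrix_vector_mult_basis column_def mult_ac)
qed

text \<open>The columns of \<open>U\<close> lie in the range of \<open>X\<close>, so \<open>U = X M\<close> with \<open>M\<close> square; \<open>U\<^sup>T U = 1\<close> makes \<open>M\<close>
  invertible, and the two ranges agree.\<close>
lemma kernel_of_gram:
  fixes X U :: "real^'d^'n"
  assumes U: "transpose U ** U = mat 1"
    and eig: "\<And>i. l $ i \<noteq> 0" "\<And>i. (X ** transpose X) *v column i U = l $ i *\<^sub>R column i U"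
    and x: "transpose U *v x = 0"
  shows "(X ** transpose X) *v x = 0"
proof -
  \<comment> \<open>The eigenvalue equation, divided by the nonzero \<open>l $ k\<close>, exhibits
    column \<open>k\<close> of \<open>U\<close> as \<open>X\<close> applied to column
    \<open>k\<close> of \<open>M\<close>.\<close>
  define M :: "real^'d^'d" where "M = (\<chi> i k. (transpose X *v column k U) $ i / l $ k)"
  have "X ** M = U"
  proof -
    have "(X ** M) $ i $ k = ((X ** transpose X) *v column k U) $ i / l $ k" for i k
      unfolding matrix_vector_mul_assoc[symmetric] M_def matrix_vector_mult_def[of X]
      by (simp add: matrix_matrix_mult_def sum_divide_distrib del: transpose_matrix_vector)
    then show ?thesis
      by (simp add: eig vec_eq_iff) (simp add: column_def)
  qed
  then have "(transpose U ** X) ** M = mat 1"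
    using U by (simp flip: matrix_mul_assoc)
  then have "M ** (transpose U ** X) = mat 1"
    by (simp add: matrix_left_right_inverse)
  then have "U ** (transpose U ** X) = X"
    by (metis \<open>X ** M = U\<close> matrix_mul_assoc matrix_mul_rid)
  then have "transpose X = transpose X ** U ** transpose U"
    by (metis matrix_transpose_mul transpose_transpose)
  then have "transpose X *v x = transpose X *v (U *v (transpose U *v x))"
    by (metis matrix_vector_mul_assoc)
  then show ?thesis
    using x by (simp add: matrix_vector_mul_assoc[symmetric] del: transpose_matrix_vector)
qed

section \<open>Score and information for independent Bernoulli edges\<close>

lemma has_real_derivative_along:
  assumes "(f has_derivative D) (at x)"
  shows "((\<lambda>s. f (x + s *\<^sub>R v)) has_real_derivative D v) (at 0)"
proof -
  interpret D: bounded_linear D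
    using assms by (rule has_derivative_bounded_linear)
  have "((\<lambda>s::real. x + s *\<^sub>R v) has_derivative (\<lambda>s. s *\<^sub>R v)) (at 0)"
    by (auto intro!: derivative_eq_intros)
  moreover have "(f has_derivative D) (at (x + 0 *\<^sub>R v))"
    using assms by simp
  ultimately have "((\<lambda>s. f (x + s *\<^sub>R v)) has_derivative (\<lambda>s. D (s *\<^sub>R v))) (at 0)"
    by (rule has_derivative_compose)
  then show ?thesis
    by (simp add: has_field_derivative_def D.scaleR mult_commute_abs)
qed

text \<open>\<open>deriv\<close> selects some derivative, so \<open>partial\<close> can be evaluated
  only once a derivative is known to exist.\<close>

lemma partial_eq:
  assumes "(f has_derivative (\<lambda>h. g \<bullet> h)) (at x)"
  shows "partial a f x = g $ a"
  unfolding partial_def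
  using DERIV_imp_deriv[OF has_real_derivative_along[OF assms, of "axis a 1"]]
  by (simp add: inner_axis)

text \<open>The inequality for finite sums, with the square root of the mass attached to each
  factor.\<close>

lemma pmf_Cauchy_Schwarz:
  fixes f g :: "'a \<Rightarrow> real"
  assumes "finite (set_pmf p)"
  shows "(measure_pmf.expectation p (\<lambda>x. f x * g x))\<^sup>2 \<le>
    measure_pmf.expectation p (\<lambda>x. (f x)\<^sup>2) * measure_pmf.expectation p (\<lambda>x. (g x)\<^sup>2)"
proof -
  have E: "measure_pmf.expectation p h = (\<Sum>x\<in>set_pmf p. h x * pmf p x)" for h :: "'a \<Rightarrow> real"
    using assms by (intro integral_measure_pmf_real)
  have "(\<Sum>x\<in>set_pmf p. (f x * sqrt (pmf p x)) * (g x * sqrt (pmf p x)))\<^sup>2 \<le>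
      (\<Sum>x\<in>set_pmf p. (f x * sqrt (pmf p x))\<^sup>2) * (\<Sum>x\<in>set_pmf p. (g x * sqrt (pmf p x))\<^sup>2)"
    by (rule Cauchy_Schwarz_ineq_sum)
  moreover have "(f x * sqrt (pmf p x)) * (g x * sqrt (pmf p x)) = f x * g x * pmf p x" for x
    by (simp add: mult_ac flip: real_sqrt_mult)
  ultimately show ?thesis
    unfolding E by (simp add: power_mult_distrib)
qed

section \<open>Observed edges and the law of the data\<close>

definition edges :: "nat \<Rightarrow> (nat \<times> 'n::{finite,linorder} \<times> 'n) set" where
  "edges T = {(t, i, j). t \<le> T \<and> i < j}"

definition edge_prob :: "('k::finite, 'n::{finite,linorder}) matrix_path \<Rightarrow> nat \<times> 'n \<times> 'n \<Rightarrow> real^'k \<Rightarrow> real" where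
  "edge_prob P = (\<lambda>(t, i, j) \<theta>. P (real t) \<theta> $ i $ j)"

lemma edges_eq: "edges T = {0..T} \<times> {(i, j). i < j}"
  by (auto simp: edges_def)

lemma finite_edges [simp]: "finite (edges T)"
  unfolding edges_eq by (intro finite_cartesian_product) auto

lemma sum_edges: "(\<Sum>t=0..T. \<Sum>(i, j) | i < j. f t i j) = (\<Sum>(t, i, j)\<in>edges T. f t i j)"
  unfolding edges_eq by (simp add: sum.cartesian_product split_def)

lemma data_law_eq: "data_law T P \<theta> = Pi_pmf (edges T) False (\<lambda>e. bernoulli_pmf (edge_prob P e \<theta>))"
  by (simp add: data_law_def edges_def edge_prob_def split_def)

text \<open>The type of graphs is infinite, since times range over all naturals, but coordinates
  outside \<open>edges T\<close> are frozen at \<open>False\<close>. All expectations are therefore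
  finite sums.\<close>

lemma finite_data_law [simp]: "finite (set_pmf (data_law T P \<theta>))"
proof (rule finite_subset)
  show "set_pmf (data_law T P \<theta>) \<subseteq> PiE_dflt (edges T) False (\<lambda>_. UNIV)"
    unfolding data_law_eq using set_Pi_pmf_subset'[OF finite_edges] by (fastforce simp: PiE_dflt_def)
qed (auto intro: finite_PiE_dflt)

lemma integrable_data_law [simp]:
  fixes f :: "'n::{finite,linorder} graphs \<Rightarrow> 'b::{banach,second_countable_topology}"
  shows "integrable (measure_pmf (data_law T P \<theta>)) f"
  by (rule integrable_measure_pmf_finite) simp

lemma log_lik_eq:
  "log_lik T P A \<theta> = (\<Sum>e\<in>edges T. of_bool (A e) * ln (edge_prob P e \<theta>)
     + (1 - of_bool (A e)) * ln (1 - edge_prob P e \<theta>))"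
  unfolding log_lik_def sum_edges by (simp add: edge_prob_def split_def)

text \<open>The statistical side of the setting, local to the true parameter. The dynamics enter in
  the theorem itself, through the eigenvalue formula for the edge probabilities.\<close>

locale edge_model =
  fixes T :: nat and P :: "('k::finite, 'n::{finite,linorder}) matrix_path"
    and N :: "(real^'k) set" and \<theta> :: "real^'k"
  assumes open_N: "open N" and \<theta>_in_N: "\<theta> \<in> N"
    and smooth: "\<And>t i j. t \<le> T \<Longrightarrow> C1_on N (\<lambda>\<theta>. P (real t) \<theta> $ i $ j)"
    and nondegenerate: "\<And>t i j \<theta>'. \<lbrakk>t \<le> T; i < j; \<theta>' \<in> N\<rbrakk> \<Longrightarrow>
      0 < P (real t) \<theta>' $ i $ j \<and> P (real t) \<theta>' $ i $ j < 1"
    and regular: "fisher_regular T P \<theta>"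
begin

abbreviation E :: "('n graphs \<Rightarrow> 'b::{banach,second_countable_topology}) \<Rightarrow> 'b" where
  "E \<equiv> measure_pmf.expectation (data_law T P \<theta>)"

abbreviation p :: "nat \<times> 'n \<times> 'n \<Rightarrow> real" where
  "p e \<equiv> edge_prob P e \<theta>"

definition grad :: "nat \<times> 'n \<times> 'n \<Rightarrow> real^'k" where
  "grad e = (SOME g. (edge_prob P e has_derivative (\<lambda>h. g \<bullet> h)) (at \<theta>))"

text \<open>The gradient of the log-likelihood, in the form given by x/p - (1-x)/(1-p) =
  (x-p)/(p(1-p)) for an indicator x with mean p.\<close>

definition score :: "'n graphs \<Rightarrow> real^'k" where
  "score A = (\<Sum>e\<in>edges T. ((of_bool (A e) - p e) / (p e * (1 - p e))) *\<^sub>R grad e)"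

lemma edge_prob_bounds: "e \<in> edges T \<Longrightarrow> \<theta>' \<in> N \<Longrightarrow> 0 < edge_prob P e \<theta>' \<and> edge_prob P e \<theta>' < 1"
  using nondegenerate by (auto simp: edges_def edge_prob_def)

lemma has_derivative_edge_prob:
  assumes "e \<in> edges T"
  shows "(edge_prob P e has_derivative (\<lambda>h. grad e \<bullet> h)) (at \<theta>)"
proof -
  obtain t i j where e: "e = (t, i, j)" by (cases e)
  then have "t \<le> T" using assms by (simp add: edges_def)
  from smooth[OF this, of i j] obtain g where "(edge_prob P e has_derivative (\<lambda>h. g \<bullet> h)) (at \<theta>)"
    using \<theta>_in_N unfolding C1_on_def edge_prob_def e by auto
  then show ?thesis
    unfolding grad_def by (rule someI)
qed

lemma has_derivative_log_lik: "(log_lik T P A has_derivative (\<lambda>h. score A \<bullet> h)) (at \<theta>)"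
proof -
  have "((\<lambda>\<theta>. of_bool (A e) * ln (edge_prob P e \<theta>) + (1 - of_bool (A e)) * ln (1 - edge_prob P e \<theta>))
      has_derivative (\<lambda>h. (of_bool (A e) - p e) / (p e * (1 - p e)) * (grad e \<bullet> h))) (at \<theta>)"
    if "e \<in> edges T" for e
  proof -
    have "0 < p e" "p e < 1" using edge_prob_bounds[OF that \<theta>_in_N] by auto
    then show ?thesis
      using has_derivative_edge_prob[OF that]
      by (cases "A e") (auto intro!: derivative_eq_intros simp: fun_eq_iff divide_simps)
  qed
  then show ?thesis
    unfolding log_lik_eq[abs_def] score_def inner_sum_left inner_scaleR_left
    by (intro has_derivative_sum) auto
qed

lemma partial_log_lik: "partial a (log_lik T P A) \<theta> = score A $ a"
  by (rule partial_eq[OF has_derivative_log_lik])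

lemma fisher_info_component:
  "fisher_info T P \<theta> $ a $ b = (\<Sum>e\<in>edges T. grad e $ a * grad e $ b * (1 / (p e * (1 - p e))))"
proof -
  have "fisher_info T P \<theta> $ a $ b = (\<Sum>e\<in>edges T. partial a (edge_prob P e) \<theta> * partial b (edge_prob P e) \<theta> *
      (1 / (p e * (1 - p e))))"
    unfolding fisher_info_def vec_lambda_beta sum_edges by (simp add: edge_prob_def split_def)
  then show ?thesis
    by (simp add: partial_eq[OF has_derivative_edge_prob])
qed

text \<open>The information matrix is a sum of outer products of the edge gradients, weighted by
  inverse variances. In this form a direction orthogonal to every gradient is visibly in the
  kernel.\<close>

lemma fisher_info_mult:
  "fisher_info T P \<theta> *v h = (\<Sum>e\<in>edges T. (grad e \<bullet> h / (p e * (1 - p e))) *\<^sub>R grad e)"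
proof (rule vec_eq_iff[THEN iffD2], rule allI)
  fix a
  have "(fisher_info T P \<theta> *v h) $ a =
      (\<Sum>b\<in>UNIV. \<Sum>e\<in>edges T. grad e $ a * grad e $ b * (1 / (p e * (1 - p e))) * h $ b)"
    by (simp add: matrix_vector_mult_def fisher_info_component sum_distrib_right)
  also have "\<dots> = (\<Sum>e\<in>edges T. \<Sum>b\<in>UNIV. grad e $ a * grad e $ b * (1 / (p e * (1 - p e))) * h $ b)"
    by (rule sum.swap)
  also have "\<dots> = (\<Sum>e\<in>edges T. (grad e \<bullet> h / (p e * (1 - p e))) * grad e $ a)"
    by (simp add: inner_vec_def sum_distrib_left sum_distrib_right sum_divide_distrib mult_ac)
  finally show "(fisher_info T P \<theta> *v h) $ a =
      (\<Sum>e\<in>edges T. (grad e \<bullet> h / (p e * (1 - p e))) *\<^sub>R grad e) $ a"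
    by simp
qed

lemma fisher_info_form:
  "v \<bullet> (fisher_info T P \<theta> *v h) = (\<Sum>e\<in>edges T. (grad e \<bullet> h / (p e * (1 - p e))) * (grad e \<bullet> v))"
  by (simp add: fisher_info_mult inner_sum_right inner_commute)

lemma fisher_info_nonneg: "0 \<le> v \<bullet> (fisher_info T P \<theta> *v v)"
  unfolding fisher_info_form
proof (rule sum_nonneg)
  fix e :: "nat \<times> 'n \<times> 'n" assume "e \<in> edges T"
  from edge_prob_bounds[OF this \<theta>_in_N] have "0 < p e * (1 - p e)"
    by simp
  moreover have "grad e \<bullet> v / (p e * (1 - p e)) * (grad e \<bullet> v) = (grad e \<bullet> v)\<^sup>2 / (p e * (1 - p e))"
    by (simp add: power2_eq_square)
  ultimately show "0 \<le> grad e \<bullet> v / (p e * (1 - p e)) * (grad e \<bullet> v)"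
    by simp
qed

lemma fisher_info_symmetric: "transpose (fisher_info T P \<theta>) = fisher_info T P \<theta>"
  by (simp add: vec_eq_iff transpose_def fisher_info_component mult_ac)

text \<open>The expectation is a finite sum over \<open>?S\<close>, which contains the support for
  every parameter, of products of factors p or 1 - p. \<open>bernoulli_pmf\<close> clips its
  argument to the unit interval, so this polynomial formula is established on \<open>N\<close> and
  then transferred to \<theta> by openness.\<close>

lemma differentiable_expectation:
  fixes g :: "'n graphs \<Rightarrow> real"
  shows "(\<lambda>\<theta>'. measure_pmf.expectation (data_law T P \<theta>') g) differentiable (at \<theta>)"
proof -
  let ?S = "PiE_dflt (edges T) False (\<lambda>_. UNIV) :: 'n graphs set"
  let ?q = "\<lambda>A e \<theta>'. if A e then edge_prob P e \<theta>' else 1 - edge_prob P e \<theta>'"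
  let ?f = "\<lambda>\<theta>'. \<Sum>A\<in>?S. g A * (\<Prod>e\<in>edges T. ?q A e \<theta>')"
  have fin: "finite ?S" by (auto intro: finite_PiE_dflt)
  have eq: "?f \<theta>' = measure_pmf.expectation (data_law T P \<theta>') g" if "\<theta>' \<in> N" for \<theta>'
  proof -
    have "measure_pmf.expectation (data_law T P \<theta>') g = (\<Sum>A\<in>?S. g A * pmf (data_law T P \<theta>') A)"
    proof (rule integral_measure_pmf_real[OF fin])
      fix A assume "A \<in> set_pmf (data_law T P \<theta>')"
      then show "A \<in> ?S"
        using set_Pi_pmf_subset'[OF finite_edges] unfolding data_law_eq
        by (fastforce simp: PiE_dflt_def)
    qed
    also have "\<dots> = ?f \<theta>'"
    proof (intro sum.cong refl arg_cong2[of _ _ _ _ "(*)"])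
      fix A assume A: "A \<in> ?S"
      have "pmf (data_law T P \<theta>') A = (\<Prod>e\<in>edges T. pmf (bernoulli_pmf (edge_prob P e \<theta>')) (A e))"
        unfolding data_law_eq using A by (intro pmf_Pi') (auto simp: PiE_dflt_def)
      also have "\<dots> = (\<Prod>e\<in>edges T. ?q A e \<theta>')"
      proof (rule prod.cong[OF refl])
        fix e :: "nat \<times> 'n \<times> 'n" assume "e \<in> edges T"
        from edge_prob_bounds[OF this that] show "pmf (bernoulli_pmf (edge_prob P e \<theta>')) (A e) = ?q A e \<theta>'"
          by (cases "A e") auto
      qed
      finally show "pmf (data_law T P \<theta>') A = (\<Prod>e\<in>edges T. ?q A e \<theta>')" .
    qed
    finally show ?thesis ..
  qed
  have q': "(?q A e has_derivative (\<lambda>h. if A e then grad e \<bullet> h else - (grad e \<bullet> h))) (at \<theta>)"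
    if "e \<in> edges T" for A e
    using has_derivative_edge_prob[OF that] by (cases "A e") (auto intro!: derivative_eq_intros)
  have "\<exists>D. (?f has_derivative D) (at \<theta>)"
    by (rule exI, (rule has_derivative_sum has_derivative_mult_right has_derivative_prod q' | assumption)+)
  then obtain D where "(?f has_derivative D) (at \<theta>)" ..
  then have "((\<lambda>\<theta>'. measure_pmf.expectation (data_law T P \<theta>') g) has_derivative D) (at \<theta>)"
    by (rule has_derivative_transform_within_open[OF _ open_N \<theta>_in_N]) (rule eq)
  then show ?thesis
    unfolding differentiable_def by blast
qed

text \<open>Regularity speaks about coordinate directions only. Differentiability of the law, which is polynomial
  in the edge probabilities, extends it to every direction.\<close>
lemma has_derivative_expectation:
  fixes g :: "'n graphs \<Rightarrow> real"
  shows "((\<lambda>\<theta>'. measure_pmf.expectation (data_law T P \<theta>') g) has_derivative (\<lambda>h. E (\<lambda>A. g A * (score A \<bullet> h)))) (at \<theta>)"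
proof -
  obtain D where D: "((\<lambda>\<theta>'. measure_pmf.expectation (data_law T P \<theta>') g) has_derivative D) (at \<theta>)"
    using differentiable_expectation unfolding differentiable_def by blast
  interpret D: bounded_linear D
    using D by (rule has_derivative_bounded_linear)
  have axis: "D (axis a 1) = E (\<lambda>A. g A * score A $ a)" for a
  proof -
    have "((\<lambda>s. measure_pmf.expectation (data_law T P (\<theta> + s *\<^sub>R axis a 1)) g) has_real_derivative
        E (\<lambda>A. g A * score A $ a)) (at 0)"
      using regular unfolding fisher_regular_def partial_log_lik by blast
    then show ?thesis
      by (rule DERIV_unique[OF has_real_derivative_along[OF D]])
  qed
  have "D h = E (\<lambda>A. g A * (score A \<bullet> h))" for h
  proof -
    have "D h = D (\<Sum>a\<in>UNIV. h $ a *\<^sub>R axis a 1)"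
      by (simp add: basis_expansion[of h, unfolded scalar_mult_eq_scaleR])
    also have "\<dots> = (\<Sum>a\<in>UNIV. h $ a * E (\<lambda>A. g A * score A $ a))"
      by (simp add: D.sum D.scaleR axis)
    also have "\<dots> = E (\<lambda>A. \<Sum>a\<in>UNIV. h $ a * (g A * score A $ a))"
      by (subst Bochner_Integration.integral_sum) simp_all
    also have "\<dots> = E (\<lambda>A. g A * (score A \<bullet> h))"
      by (intro Bochner_Integration.integral_cong refl) (simp add: inner_vec_def sum_distrib_left mult_ac)
    finally show ?thesis .
  qed
  then have "D = (\<lambda>h. E (\<lambda>A. g A * (score A \<bullet> h)))" by blast
  with D show ?thesis by simp
qed

text \<open>Differentiate the expectation of the constant 1.\<close>

lemma expectation_score: "E (\<lambda>A. score A \<bullet> h) = 0"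
proof -
  have "((\<lambda>\<theta>'. measure_pmf.expectation (data_law T P \<theta>') (\<lambda>_. 1)) has_derivative (\<lambda>h. E (\<lambda>A. 1 * (score A \<bullet> h)))) (at \<theta>)"
    by (rule has_derivative_expectation)
  then have "((\<lambda>_. 1::real) has_derivative (\<lambda>h. E (\<lambda>A. score A \<bullet> h))) (at \<theta>)"
    by simp
  then show ?thesis
    using has_derivative_unique[OF _ has_derivative_const] by metis
qed

lemma expectation_edge:
  assumes "e \<in> edges T" "\<theta>' \<in> N"
  shows "measure_pmf.expectation (data_law T P \<theta>') (\<lambda>A. of_bool (A e)) = edge_prob P e \<theta>'"
proof -
  have "measure_pmf.expectation (data_law T P \<theta>') (\<lambda>A. of_bool (A e)) =
      measure_pmf.expectation (map_pmf (\<lambda>A. A e) (data_law T P \<theta>')) (of_bool :: bool \<Rightarrow> real)"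
    by simp
  also have "map_pmf (\<lambda>A. A e) (data_law T P \<theta>') = bernoulli_pmf (edge_prob P e \<theta>')"
    unfolding data_law_eq using assms(1) by (simp add: Pi_pmf_component)
  finally show ?thesis
    using edge_prob_bounds[OF assms] by simp
qed

text \<open>The edge probability is the mean of an indicator, so its derivative is known in two
  ways. Centring the indicator changes nothing because the score has mean zero.\<close>

lemma covariance_edge_score:
  assumes e: "e \<in> edges T"
  shows "E (\<lambda>A. (of_bool (A e) - p e) * (score A \<bullet> h)) = grad e \<bullet> h"
proof -
  have "((\<lambda>\<theta>'. measure_pmf.expectation (data_law T P \<theta>') (\<lambda>A. of_bool (A e))) has_derivative (\<lambda>h. grad e \<bullet> h)) (at \<theta>)"
    by (rule has_derivative_transform_within_open[OF has_derivative_edge_prob[OF e] open_N \<theta>_in_N])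
      (simp add: expectation_edge[OF e])
  then have "E (\<lambda>A. of_bool (A e) * (score A \<bullet> h)) = grad e \<bullet> h"
    by (rule fun_cong[OF has_derivative_unique[OF has_derivative_expectation]])
  then show ?thesis
    by (simp add: left_diff_distrib expectation_score)
qed

text \<open>Only one factor of the square is expanded into edges; the other stays a score, so each
  term is a covariance of the preceding kind and no joint moments of two edges appear.\<close>

lemma information_identity: "E (\<lambda>A. (score A \<bullet> h)\<^sup>2) = h \<bullet> (fisher_info T P \<theta> *v h)"
proof -
  have "E (\<lambda>A. (score A \<bullet> h)\<^sup>2) =
      E (\<lambda>A. \<Sum>e\<in>edges T. (grad e \<bullet> h / (p e * (1 - p e))) * ((of_bool (A e) - p e) * (score A \<bullet> h)))"
    by (intro Bochner_Integration.integral_cong refl, subst power2_eq_square, subst (1) score_def)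
      (simp add: inner_sum_left sum_distrib_left sum_distrib_right mult_ac)
  also have "\<dots> = (\<Sum>e\<in>edges T. (grad e \<bullet> h / (p e * (1 - p e))) * (grad e \<bullet> h))"
    by (subst Bochner_Integration.integral_sum) (simp_all add: covariance_edge_score)
  finally show ?thesis
    by (simp add: fisher_info_form)
qed

text \<open>The derivative \<open>c\<close> of the mean is the covariance of \<open>g\<close> with
  the score along \<open>u\<close>, whose second moment is the information in that
  direction.\<close>

lemma cramer_rao:
  fixes g :: "'n graphs \<Rightarrow> real"
  assumes "((\<lambda>s. measure_pmf.expectation (data_law T P (\<theta> + s *\<^sub>R u)) g) has_real_derivative c) (at 0)"
  shows "c\<^sup>2 \<le> measure_pmf.variance (data_law T P \<theta>) g * (u \<bullet> (fisher_info T P \<theta> *v u))"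
proof -
  have "c = E (\<lambda>A. g A * (score A \<bullet> u))"
    using DERIV_unique[OF assms has_real_derivative_along[OF has_derivative_expectation]] .
  also have "\<dots> = E (\<lambda>A. (g A - E g) * (score A \<bullet> u))"
    by (simp add: left_diff_distrib expectation_score)
  finally show ?thesis
    using pmf_Cauchy_Schwarz[of "data_law T P \<theta>" "\<lambda>A. g A - E g" "\<lambda>A. score A \<bullet> u"]
    by (simp add: information_identity)
qed

text \<open>Along the curve every edge probability is constant, so by the chain rule its gradient is
  orthogonal to \<open>v\<close>.\<close>

lemma unidentifiable_imp_fisher_null:
  assumes "v \<in> unidentifiable_dirs T P \<theta>"
  shows "fisher_info T P \<theta> *v v = 0"
proof -
  from assms obtain c where c: "c 0 = \<theta>" "(c has_vector_derivative v) (at 0)"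
    "\<forall>\<^sub>F s in nhds 0. data_law T P (c s) = data_law T P \<theta>"
    unfolding unidentifiable_dirs_def by blast
  \<comment> \<open>Continuity keeps the curve inside \<open>N\<close> for small \<open>s\<close>,
    where the edge probabilities can be recovered from the law.\<close>
  have "isCont c 0"
    using c(2) by (rule has_vector_derivative_continuous)
  then have "(c \<longlongrightarrow> \<theta>) (nhds 0)"
    using tendsto_at_iff_tendsto_nhds[of c 0] c(1) by (simp add: isCont_def)
  then have "\<forall>\<^sub>F s in nhds 0. c s \<in> N"
    using open_N \<theta>_in_N by (rule topological_tendstoD)
  with c(3) have ev: "\<forall>\<^sub>F s in nhds 0. c s \<in> N \<and> data_law T P (c s) = data_law T P \<theta>"
    by eventually_elim simp
  have "grad e \<bullet> v = 0" if e: "e \<in> edges T" for e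
  proof -
    have "\<forall>\<^sub>F s in nhds 0. edge_prob P e (c s) = p e"
      using ev by eventually_elim (metis expectation_edge e \<theta>_in_N)
    then have "((\<lambda>s. edge_prob P e (c s)) has_derivative (\<lambda>_. 0)) (at 0)"
      by (intro has_derivative_transform_eventually[OF has_derivative_const[of "p e"]])
        (auto simp: c(1) eventually_nhds_conv_at elim: eventually_mono)
    moreover have "((\<lambda>s. edge_prob P e (c s)) has_derivative (\<lambda>s. grad e \<bullet> (s *\<^sub>R v))) (at 0)"
      using c(2) has_derivative_edge_prob[OF e] unfolding has_vector_derivative_def c(1)[symmetric]
      by (rule has_derivative_compose)
    ultimately have "(\<lambda>s::real. grad e \<bullet> (s *\<^sub>R v)) = (\<lambda>_. 0)"
      by (metis has_derivative_unique)
    from fun_cong[OF this, of 1] show ?thesis by simp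
  qed
  then show ?thesis
    by (simp add: fisher_info_mult)
qed


section \<open>Identifiable subspace and the bounds on it\<close>

abbreviation S :: "(real^'k) set" where
  "S \<equiv> identifiable_subspace T P \<theta>"

abbreviation J :: "real^'k^'k" where
  "J \<equiv> fisher_info T P \<theta>"

lemma subspace_identifiable: "subspace S"
  unfolding identifiable_subspace_def by (rule subspace_orthogonal_comp)

text \<open>For a symmetric matrix the range is orthogonal to the kernel, and the kernel contains
  all unidentifiable directions.\<close>

lemma fisher_info_in_identifiable: "J *v w \<in> S"
proof -
  have "v \<bullet> (J *v w) = 0" if "v \<in> unidentifiable_dirs T P \<theta>" for v
    using unidentifiable_imp_fisher_null[OF that] inner_matrix_symmetric[OF fisher_info_symmetric, of v w]
    by simp
  then show ?thesis
    by (simp add: identifiable_subspace_def orthogonal_comp_def orthogonal_def)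
qed

lemma pinv_fisher_info:
  assumes "pos_def_on S J"
  obtains R where "transpose R = R" "\<And>x. R *v x \<in> S" "\<And>x. x \<in> S \<Longrightarrow> R *v x = x"
    "J ** pinv J = R" "R ** pinv J = pinv J" "pinv J ** R = pinv J" "transpose (pinv J) = pinv J"
    "pinv J ** J ** pinv J = pinv J"
proof -
  obtain R where R: "transpose R = R" "\<And>x. R *v x \<in> S" "\<And>x. x \<in> S \<Longrightarrow> R *v x = x"
    using orthogonal_projection_matrix[OF subspace_identifiable] by metis
  have "R ** J = J"
    by (rule matrix_eq[THEN iffD2])
      (simp add: R(3) fisher_info_in_identifiable flip: matrix_vector_mul_assoc)
  then have "J ** R = J"
    by (metis R(1) fisher_info_symmetric matrix_transpose_mul)
  from pinv_on_subspace[OF assms R this] have "J ** pinv J = R" "R ** pinv J = pinv J" "pinv J ** R = pinv J"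
      "transpose (pinv J) = pinv J" "pinv J ** J ** pinv J = pinv J"
    by simp_all
  from that[OF R this] show thesis
    by simp
qed

lemma pinv_fisher_info_form:
  assumes "pos_def_on S J"
  shows "(pinv J *v v) \<bullet> (J *v (pinv J *v v)) = v \<bullet> (pinv J *v v)"
  using pinv_fisher_info[OF assms]
  by (metis inner_matrix_symmetric matrix_vector_mul_assoc)

text \<open>Cauchy-Schwarz for the form \<open>J\<close> between \<open>w\<close> and
  \<open>pinv J *v w\<close>, using that \<open>J\<close> maps the latter back to \<open>w\<close>.
  At a coordinate vector it becomes the comparison of diagonal entries.\<close>

lemma inner_power4_le_fisher_pinv:
  assumes "pos_def_on S J" and w: "w \<in> S"
  shows "(w \<bullet> w)\<^sup>2 \<le> (w \<bullet> (J *v w)) * (w \<bullet> (pinv J *v w))"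
proof -
  have "J *v (pinv J *v w) = w"
    using pinv_fisher_info[OF assms(1)] w by (metis matrix_vector_mul_assoc)
  then show ?thesis
    using semidefinite_Cauchy_Schwarz[OF fisher_info_symmetric fisher_info_nonneg, of w "pinv J *v w"]
    by (simp add: inner_commute)
qed

lemma pinv_diagonal_ge:
  assumes pd: "pos_def_on S J" and a: "axis a 1 \<in> S"
  shows "1 / J $ a $ a \<le> pinv J $ a $ a"
proof -
  have diag: "axis a 1 \<bullet> (M *v axis a 1) = M $ a $ a" for M :: "real^'k^'k"
    by (simp add: matrix_vector_mult_basis column_def inner_axis')
  have "0 < J $ a $ a"
    using pd a by (auto simp: pos_def_on_def simp flip: diag)
  moreover have "1 \<le> J $ a $ a * pinv J $ a $ a"
    using inner_power4_le_fisher_pinv[OF pd a] unfolding diag by (simp add: inner_axis')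
  ultimately show ?thesis
    by (simp add: field_simps)
qed

text \<open>The direction \<open>u = pinv J *v v\<close> is the least favourable one: the mean of
  the estimated \<open>v\<close>-component moves along it at rate \<open>v \<bullet> u\<close>,
  which is also the information in direction \<open>u\<close>. One factor
  \<open>v \<bullet> u\<close> then cancels.\<close>

lemma variance_ge:
  assumes pd: "pos_def_on S J" and v: "v \<in> S"
    and est: "unbiased_along T P \<Theta> S \<theta> est" and N: "N \<subseteq> \<Theta>"
  shows "v \<bullet> (pinv J *v v) \<le> measure_pmf.variance (data_law T P \<theta>) (\<lambda>A. v \<bullet> est A)"
proof -
  define u where "u = pinv J *v v"
  \<comment> \<open>Moving along \<open>u\<close> stays in the slice \<open>\<theta> + S\<close>, on
    which unbiasedness is assumed.\<close>
  have "u \<in> S"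
    using pinv_fisher_info[OF pd] unfolding u_def by (metis matrix_vector_mul_assoc)
  have "((\<lambda>s. \<theta> + s *\<^sub>R u) \<longlongrightarrow> \<theta> + 0 *\<^sub>R u) (nhds (0::real))"
    by (intro tendsto_intros filterlim_ident)
  then have "((\<lambda>s. \<theta> + s *\<^sub>R u) \<longlongrightarrow> \<theta>) (nhds (0::real))"
    by simp
  then have "\<forall>\<^sub>F s in nhds 0. \<theta> + s *\<^sub>R u \<in> N"
    using open_N \<theta>_in_N by (rule topological_tendstoD)
  then have ev: "\<forall>\<^sub>F s in nhds 0. measure_pmf.expectation (data_law T P (\<theta> + s *\<^sub>R u)) (\<lambda>A. v \<bullet> est A) = v \<bullet> (\<theta> + s *\<^sub>R u)"
  proof eventually_elim
    case (elim s)
    have "s *\<^sub>R u \<in> S"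
      using \<open>u \<in> S\<close> subspace_identifiable by (rule subspace_scale[rotated])
    then show ?case
      using est v elim N by (auto simp: unbiased_along_def)
  qed
  have "((\<lambda>s. v \<bullet> (\<theta> + s *\<^sub>R u)) has_real_derivative v \<bullet> u) (at 0)"
    by (rule has_real_derivative_along) (rule bounded_linear_imp_has_derivative[OF bounded_linear_inner_right])
  then have "((\<lambda>s. measure_pmf.expectation (data_law T P (\<theta> + s *\<^sub>R u)) (\<lambda>A. v \<bullet> est A))
      has_real_derivative v \<bullet> u) (at 0)"
    by (subst DERIV_cong_ev[OF refl ev refl])
  from cramer_rao[OF this]
  have le: "(v \<bullet> u)\<^sup>2 \<le> measure_pmf.variance (data_law T P \<theta>) (\<lambda>A. v \<bullet> est A) * (v \<bullet> u)"
    by (simp add: u_def pinv_fisher_info_form[OF pd])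
  have "0 \<le> v \<bullet> u"
    using fisher_info_nonneg[of u] by (simp add: u_def pinv_fisher_info_form[OF pd])
  show ?thesis
  proof (cases "v \<bullet> u = 0")
    \<comment> \<open>Here the claim is just that a variance is nonnegative.\<close>
    case True
    then show ?thesis
      by (simp add: u_def)
  next
    case False
    with \<open>0 \<le> v \<bullet> u\<close> have "0 < v \<bullet> u" by simp
    with le have "v \<bullet> u \<le> measure_pmf.variance (data_law T P \<theta>) (\<lambda>A. v \<bullet> est A)"
      by (simp only: power2_eq_square mult_le_cancel_right_pos)
    then show ?thesis by (simp add: u_def)
  qed
qed

lemma variance_component_ge:
  assumes "pos_def_on S J" and a: "axis a 1 \<in> S"
    and "unbiased_along T P \<Theta> S \<theta> est" and "N \<subseteq> \<Theta>"
  shows "pinv J $ a $ a \<le> measure_pmf.variance (data_law T P \<theta>) (\<lambda>A. est A $ a)"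
  using variance_ge[OF assms]
  by (simp add: matrix_vector_mult_basis column_def inner_axis')

text \<open>Coordinate vectors may lie outside \<open>S\<close>, so the variance bound is applied to
  their projections \<open>r a\<close>. Since \<open>R ** pinv J ** R = pinv J\<close>, the form at
  \<open>r a\<close> is still a diagonal entry, and summation gives the trace on one side and the
  projected squared error on the other.\<close>

lemma expectation_projected_norm_ge:
  assumes pd: "pos_def_on S J"
    and est: "unbiased_along T P \<Theta> S \<theta> est" and N: "N \<subseteq> \<Theta>"
  shows "trace (pinv J) \<le> E (\<lambda>A. (norm (closest_point S (est A - \<theta>)))\<^sup>2)"
proof -
  obtain R where R: "transpose R = R" "\<And>x. R *v x \<in> S" "\<And>x. x \<in> S \<Longrightarrow> R *v x = x"
    and RB: "R ** pinv J = pinv J" "pinv J ** R = pinv J"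
    using pinv_fisher_info[OF pd] by metis
  define r where "r a = R *v axis a 1" for a
  have r: "r a \<bullet> x = (R *v x) $ a" for a x
    by (simp add: r_def inner_matrix_symmetric[OF R(1), symmetric] inner_axis')
  \<comment> \<open>Unbiasedness at \<theta> itself turns the variance of each projected component
    into its mean squared error.\<close>
  have mean: "r a \<bullet> E est = r a \<bullet> \<theta>" for a
    using est N \<theta>_in_N R(2) subspace_0[OF subspace_identifiable]
    by (auto simp: unbiased_along_def r_def)
  have "pinv J $ a $ a \<le> E (\<lambda>A. ((R *v (est A - \<theta>)) $ a)\<^sup>2)" for a
  proof -
    have "pinv J $ a $ a = axis a 1 \<bullet> (R ** pinv J ** R *v axis a 1)"
      by (simp add: RB matrix_vector_mult_basis column_def inner_axis')
    also have "\<dots> = r a \<bullet> (pinv J *v r a)"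
      unfolding r_def by (simp add: inner_matrix_symmetric[OF R(1)] flip: matrix_vector_mul_assoc)
    also have "\<dots> \<le> measure_pmf.variance (data_law T P \<theta>) (\<lambda>A. r a \<bullet> est A)"
      using R(2) by (intro variance_ge[OF pd _ est N]) (simp add: r_def)
    also have "\<dots> = E (\<lambda>A. ((R *v (est A - \<theta>)) $ a)\<^sup>2)"
      by (simp add: mean inner_diff_right flip: r)
    finally show ?thesis .
  qed
  then have "trace (pinv J) \<le> (\<Sum>a\<in>UNIV. E (\<lambda>A. ((R *v (est A - \<theta>)) $ a)\<^sup>2))"
    unfolding trace_def by (rule sum_mono)
  also have "\<dots> = E (\<lambda>A. \<Sum>a\<in>UNIV. ((R *v (est A - \<theta>)) $ a)\<^sup>2)"
    by (subst Bochner_Integration.integral_sum) simp_all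
  also have "\<dots> = E (\<lambda>A. (norm (closest_point S (est A - \<theta>)))\<^sup>2)"
    by (simp add: closest_point_projection(1)[OF subspace_identifiable R] norm_vec_def L2_set_def sum_nonneg)
  finally show ?thesis .
qed

text \<open>Projecting the error onto \<open>S\<close> does not increase its norm.\<close>

lemma expectation_norm_ge:
  assumes "pos_def_on S J" "unbiased_along T P \<Theta> S \<theta> est" "N \<subseteq> \<Theta>"
  shows "trace (pinv J) \<le> E (\<lambda>A. (norm (est A - \<theta>))\<^sup>2)"
proof -
  obtain R where R: "transpose R = R" "\<And>x. R *v x \<in> S" "\<And>x. x \<in> S \<Longrightarrow> R *v x = x"
    using orthogonal_projection_matrix[OF subspace_identifiable] by metis
  have "E (\<lambda>A. (norm (closest_point S (est A - \<theta>)))\<^sup>2) \<le> E (\<lambda>A. (norm (est A - \<theta>))\<^sup>2)"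
    by (intro integral_mono)
      (auto simp: closest_point_projection(1)[OF subspace_identifiable R]
        intro!: power_mono closest_point_projection(2)[OF subspace_identifiable R])
  with expectation_projected_norm_ge[OF assms] show ?thesis
    by linarith
qed

lemma identifiable_subspace_UNIV:
  assumes "invertible J"
  shows "S = UNIV"
proof -
  have "v = 0" if "v \<in> unidentifiable_dirs T P \<theta>" for v
    using unidentifiable_imp_fisher_null[OF that] assms
    by (metis invertible_left_inverse matrix_left_invertible_ker)
  then have "v \<bullet> x = 0" if "v \<in> unidentifiable_dirs T P \<theta>" for v x
    using that by (metis inner_zero_left)
  then show ?thesis
    by (simp add: identifiable_subspace_def orthogonal_comp_def orthogonal_def set_eq_iff)
qed

end

section \<open>The bounds for polynomial dynamics\<close>

lemma unbiased_imp_unbiased_along: "unbiased T P \<Theta> est \<Longrightarrow> unbiased_along T P \<Theta> S \<theta> est"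
  by (simp add: unbiased_def unbiased_along_def)

theorem proposition14:
  fixes K T :: nat
    and ix :: "nat \<Rightarrow> 'k::finite"
    and \<Theta> N :: "(real^'k) set"
    and \<theta> :: "real^'k"
    and X :: "real \<Rightarrow> real^'k \<Rightarrow> real^'d^('n::{finite,linorder})"
    and X0 U :: "real^'d^('n::{finite,linorder})"
    and P :: "('k, 'n) matrix_path"
    and lam :: "real \<Rightarrow> real^'k \<Rightarrow> real^'d"
  assumes dims: "CARD('n) \<ge> CARD('d)" "CARD('d) \<ge> 2"
    and coordinates: "bij_betw ix {0..K} UNIV"
    and P_eq: "\<And>t \<theta>. P t \<theta> = X t \<theta> ** transpose (X t \<theta>)"
    and dynamics: "\<And>\<theta> t. \<lbrakk>\<theta> \<in> \<Theta>; t \<in> {0..real T}\<rbrakk> \<Longrightarrow>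
      ((\<lambda>s. X s \<theta>) has_vector_derivative (poly_mat K ix \<theta> (P t \<theta>) ** X t \<theta>))
        (at t within {0..real T})"
    and full_rank: "\<And>\<theta> t. \<lbrakk>\<theta> \<in> \<Theta>; t \<in> {0..real T}\<rbrakk> \<Longrightarrow> rank (X t \<theta>) = CARD('d)"
    and initial: "\<And>\<theta>. \<theta> \<in> \<Theta> \<Longrightarrow> X 0 \<theta> = X0"
    and probabilities: "\<And>\<theta> t i j. \<lbrakk>\<theta> \<in> \<Theta>; t \<le> T; i < j\<rbrakk> \<Longrightarrow> P (real t) \<theta> $ i $ j \<in> {0..1}"
    and U_orthonormal: "transpose U ** U = mat 1"
    and U_eigenvectors: "\<And>\<theta> \<iota>. \<theta> \<in> \<Theta> \<Longrightarrow> lam 0 \<theta> $ \<iota> \<noteq> 0 \<and>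
      (X0 ** transpose X0) *v column \<iota> U = (lam 0 \<theta> $ \<iota>) *\<^sub>R column \<iota> U"
    and lam_ode: "\<And>\<theta> \<iota> t. \<lbrakk>\<theta> \<in> \<Theta>; t \<in> {0..real T}\<rbrakk> \<Longrightarrow>
      ((\<lambda>s. lam s \<theta> $ \<iota>) has_real_derivative
        2 * (\<Sum>k=0..K. \<theta> $ ix k * (lam t \<theta> $ \<iota>) ^ (k + 1))) (at t within {0..real T})"
    and parameter_set: "open \<Theta>" "\<theta> \<in> interior \<Theta>"
    and neighborhood: "open N" "\<theta> \<in> N" "N \<subseteq> \<Theta>"
    and smooth: "\<And>t i j. t \<le> T \<Longrightarrow> C1_on N (\<lambda>\<theta>. P (real t) \<theta> $ i $ j)"
    and nondegenerate: "\<And>t i j \<theta>'. \<lbrakk>t \<le> T; i < j; \<theta>' \<in> N\<rbrakk> \<Longrightarrow> 0 < P (real t) \<theta>' $ i $ j \<and> P (real t) \<theta>' $ i $ j < 1"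
    and regular: "fisher_regular T P \<theta>"
    and information_pos_def: "pos_def_on (identifiable_subspace T P \<theta>) (fisher_info T P \<theta>)"
  shows
    \<comment> \<open>entries of the Fisher information matrix\<close>
    "(\<forall>a b. fisher_info T P \<theta> $ a $ b =
        (\<Sum>t=0..T. \<Sum>\<iota>\<in>UNIV. \<Sum>\<gamma>\<in>UNIV.
           partial a (\<lambda>\<theta>. lam (real t) \<theta> $ \<iota>) \<theta> * partial b (\<lambda>\<theta>. lam (real t) \<theta> $ \<gamma>) \<theta> *
           eig_coupling U (P (real t) \<theta>) \<iota> \<gamma>)) \<and>
     (\<forall>t\<le>T. \<forall>\<iota>. eig_coupling U (P (real t) \<theta>) \<iota> \<iota> = eig_weight U (P (real t) \<theta>) \<iota>) \<and>
     (\<forall>a. 1 / fisher_info T P \<theta> $ a $ a =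
        1 / ((\<Sum>t=0..T. \<Sum>\<iota>\<in>UNIV.
                (partial a (\<lambda>\<theta>. lam (real t) \<theta> $ \<iota>) \<theta>)\<^sup>2 * eig_weight U (P (real t) \<theta>) \<iota>)
             + cross_terms T P U lam \<theta> a)) \<and>
     \<comment> \<open>nonsingular case\<close>
     (invertible (fisher_info T P \<theta>) \<longrightarrow>
        (\<forall>a. matrix_inv (fisher_info T P \<theta>) $ a $ a \<ge> 1 / fisher_info T P \<theta> $ a $ a) \<and>
        (\<forall>est. unbiased T P \<Theta> est \<longrightarrow>
           measure_pmf.expectation (data_law T P \<theta>) (\<lambda>A. (norm (est A - \<theta>))\<^sup>2)
             \<ge> trace (matrix_inv (fisher_info T P \<theta>)) \<and>
           (\<forall>a. measure_pmf.variance (data_law T P \<theta>) (\<lambda>A. est A $ a)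
                  \<ge> matrix_inv (fisher_info T P \<theta>) $ a $ a \<and>
                measure_pmf.variance (data_law T P \<theta>) (\<lambda>A. est A $ a)
                  \<ge> 1 / fisher_info T P \<theta> $ a $ a))) \<and>
     \<comment> \<open>general case, on the identifiable subspace\<close>
     (let S = identifiable_subspace T P \<theta> in
        (\<forall>a. axis a 1 \<in> S \<longrightarrow>
           pinv (fisher_info T P \<theta>) $ a $ a \<ge> 1 / fisher_info T P \<theta> $ a $ a) \<and>
        (\<forall>est. unbiased_along T P \<Theta> S \<theta> est \<longrightarrow>
           measure_pmf.expectation (data_law T P \<theta>) (\<lambda>A. (norm (est A - \<theta>))\<^sup>2)
             \<ge> trace (pinv (fisher_info T P \<theta>)) \<and>
           measure_pmf.expectation (data_law T P \<theta>) (\<lambda>A. (norm (closest_point S (est A - \<theta>)))\<^sup>2)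
             \<ge> trace (pinv (fisher_info T P \<theta>)) \<and>
           (\<forall>a. axis a 1 \<in> S \<longrightarrow>
              measure_pmf.variance (data_law T P \<theta>) (\<lambda>A. est A $ a)
                \<ge> pinv (fisher_info T P \<theta>) $ a $ a \<and>
              measure_pmf.variance (data_law T P \<theta>) (\<lambda>A. est A $ a)
                \<ge> 1 / fisher_info T P \<theta> $ a $ a)))"
proof -
  interpret edge_model T P N \<theta>
    by unfold_locales (use neighborhood smooth nondegenerate regular in auto)
  \<comment> \<open>The same \<open>U\<close> serves all parameters in \<Theta> and all times,
    because the initial state does not depend on the parameter. Hence only the eigenvalues carry
    derivatives below.\<close>
  have entries: "P t \<theta>' $ i $ j = (\<Sum>\<iota>\<in>UNIV. U $ i $ \<iota> * U $ j $ \<iota> * lam t \<theta>' $ \<iota>)"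
    if "\<theta>' \<in> \<Theta>" "t \<in> {0..real T}" for \<theta>' t i j
  proof (rule spectral_decomposition[OF _ _ U_orthonormal])
    have X: "((\<lambda>s. X s \<theta>') has_vector_derivative
        (poly_mat K ix \<theta>' (X t \<theta>' ** transpose (X t \<theta>')) ** X t \<theta>')) (at t within {0..real T})"
      if "t \<in> {0..real T}" for t
      using dynamics[OF \<open>\<theta>' \<in> \<Theta>\<close> that] by (simp add: P_eq)
    show "P t \<theta>' *v column \<iota> U = lam t \<theta>' $ \<iota> *\<^sub>R column \<iota> U" for \<iota>
      unfolding P_eq
      by (rule eigenvector_stationary[where X = "\<lambda>s. X s \<theta>'" and l = "\<lambda>s. lam s \<theta>' $ \<iota>", OF X lam_ode])
        (use that U_eigenvectors initial in auto)
    show "P t \<theta>' *v x = 0" if x: "transpose U *v x = 0" for x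
    proof -
      have "(X0 ** transpose X0) *v x = 0"
        using kernel_of_gram[OF U_orthonormal _ _ x, of "lam 0 \<theta>'" X0] U_eigenvectors[OF \<open>\<theta>' \<in> \<Theta>\<close>] by auto
      \<comment> \<open>Each term of the eigenvalue equation has exponent at least 1, so the zero
        function solves it and kernel vectors of the initial matrix remain in the kernel.\<close>
      moreover have "((\<lambda>s. 0) has_real_derivative 2 * (\<Sum>k=0..K. \<theta>' $ ix k * 0 ^ (k + 1))) (at t within {0..real T})" for t
        by simp
      ultimately have "(X t \<theta>' ** transpose (X t \<theta>')) *v x = 0 *\<^sub>R x"
        by (intro eigenvector_stationary[where X = "\<lambda>s. X s \<theta>'" and l = "\<lambda>s. 0", OF X _ _ \<open>t \<in> _\<close>])
          (simp_all only: initial[OF \<open>\<theta>' \<in> \<Theta>\<close>] scaleR_zero_left)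
      then show ?thesis by (simp add: P_eq)
    qed
  qed
  \<comment> \<open>Inverting the expansion by orthonormality expresses each eigenvalue linearly in
    the entries of \<open>P\<close>. Differentiability of \<open>lam\<close> in the parameter is
    thereby inherited from the smoothness of \<open>P\<close>.\<close>
  have lam_eq: "lam t \<theta>' $ \<iota> = (\<Sum>i\<in>UNIV. \<Sum>j\<in>UNIV. U $ i $ \<iota> * U $ j $ \<iota> * P t \<theta>' $ i $ j)"
    if "\<theta>' \<in> \<Theta>" "t \<in> {0..real T}" for \<theta>' t \<iota>
  proof -
    have orth: "(\<Sum>i\<in>UNIV. U $ i $ \<iota> * U $ i $ \<gamma>) = (if \<iota> = \<gamma> then 1 else 0)" for \<gamma>
      using arg_cong[OF U_orthonormal, of "\<lambda>M. M $ \<iota> $ \<gamma>"]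
      by (simp add: matrix_matrix_mult_def transpose_def mat_def)
    have "(\<Sum>i\<in>UNIV. \<Sum>j\<in>UNIV. U $ i $ \<iota> * U $ j $ \<iota> * P t \<theta>' $ i $ j) =
        (\<Sum>i\<in>UNIV. \<Sum>j\<in>UNIV. \<Sum>\<gamma>\<in>UNIV. (U $ i $ \<iota> * U $ i $ \<gamma>) * (U $ j $ \<iota> * U $ j $ \<gamma>) * lam t \<theta>' $ \<gamma>)"
      by (simp add: entries[OF that] sum_distrib_left mult_ac)
    also have "\<dots> = (\<Sum>i\<in>UNIV. \<Sum>\<gamma>\<in>UNIV. \<Sum>j\<in>UNIV. (U $ i $ \<iota> * U $ i $ \<gamma>) * (U $ j $ \<iota> * U $ j $ \<gamma>) * lam t \<theta>' $ \<gamma>)"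
      by (intro sum.cong refl sum.swap)
    also have "\<dots> = (\<Sum>\<gamma>\<in>UNIV. \<Sum>i\<in>UNIV. \<Sum>j\<in>UNIV. (U $ i $ \<iota> * U $ i $ \<gamma>) * (U $ j $ \<iota> * U $ j $ \<gamma>) * lam t \<theta>' $ \<gamma>)"
      by (rule sum.swap)
    also have "\<dots> = (\<Sum>\<gamma>\<in>UNIV. (\<Sum>i\<in>UNIV. U $ i $ \<iota> * U $ i $ \<gamma>) * (\<Sum>j\<in>UNIV. U $ j $ \<iota> * U $ j $ \<gamma>) * lam t \<theta>' $ \<gamma>)"
      unfolding sum_product by (simp only: sum_distrib_right)
    also have "\<dots> = (\<Sum>\<gamma>\<in>UNIV. if \<iota> = \<gamma> then lam t \<theta>' $ \<gamma> else 0)"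
      by (intro sum.cong refl) (simp add: orth)
    finally show ?thesis
      by simp
  qed
  have \<theta>_in: "\<theta> \<in> \<Theta>" using neighborhood by blast
  have "\<exists>g. \<forall>\<iota>. ((\<lambda>\<theta>. lam (real t) \<theta> $ \<iota>) has_derivative (\<lambda>h. g \<iota> \<bullet> h)) (at \<theta>)" if "t \<le> T" for t
  proof -
    have "\<exists>g. ((\<lambda>\<theta>. P (real t) \<theta> $ i $ j) has_derivative (\<lambda>h. g \<bullet> h)) (at \<theta>)" for i j
      using smooth[OF that, of i j] neighborhood(2) unfolding C1_on_def by blast
    then obtain g where g: "((\<lambda>\<theta>. P (real t) \<theta> $ i $ j) has_derivative (\<lambda>h. g i j \<bullet> h)) (at \<theta>)" for i j
      by metis
    have "((\<lambda>\<theta>. \<Sum>i\<in>UNIV. \<Sum>j\<in>UNIV. U $ i $ \<iota> * U $ j $ \<iota> * P (real t) \<theta> $ i $ j) has_derivative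
        (\<lambda>h. (\<Sum>i\<in>UNIV. \<Sum>j\<in>UNIV. (U $ i $ \<iota> * U $ j $ \<iota>) *\<^sub>R g i j) \<bullet> h)) (at \<theta>)" for \<iota>
      unfolding inner_sum_left inner_scaleR_left
      by (intro has_derivative_sum has_derivative_mult_right g)
    then have "((\<lambda>\<theta>. lam (real t) \<theta> $ \<iota>) has_derivative
        (\<lambda>h. (\<Sum>i\<in>UNIV. \<Sum>j\<in>UNIV. (U $ i $ \<iota> * U $ j $ \<iota>) *\<^sub>R g i j) \<bullet> h)) (at \<theta>)" for \<iota>
      by (rule has_derivative_transform_within_open[OF _ neighborhood(1,2)])
        (use lam_eq that neighborhood(3) in auto)
    then show ?thesis by (intro exI allI)
  qed
  then obtain g where g: "((\<lambda>\<theta>. lam (real t) \<theta> $ \<iota>) has_derivative (\<lambda>h. g t \<iota> \<bullet> h)) (at \<theta>)"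
    if "t \<le> T" for t \<iota>
    by metis
  have partial_P: "partial a (\<lambda>\<theta>. P (real t) \<theta> $ i $ j) \<theta> =
      (\<Sum>\<iota>\<in>UNIV. U $ i $ \<iota> * U $ j $ \<iota> * partial a (\<lambda>\<theta>. lam (real t) \<theta> $ \<iota>) \<theta>)" if "t \<le> T" for a t i j
  proof -
    have "((\<lambda>\<theta>. \<Sum>\<iota>\<in>UNIV. U $ i $ \<iota> * U $ j $ \<iota> * lam (real t) \<theta> $ \<iota>) has_derivative
        (\<lambda>h. (\<Sum>\<iota>\<in>UNIV. (U $ i $ \<iota> * U $ j $ \<iota>) *\<^sub>R g t \<iota>) \<bullet> h)) (at \<theta>)"
      unfolding inner_sum_left inner_scaleR_left
      by (intro has_derivative_sum has_derivative_mult_right g that)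
    then have "((\<lambda>\<theta>. P (real t) \<theta> $ i $ j) has_derivative
        (\<lambda>h. (\<Sum>\<iota>\<in>UNIV. (U $ i $ \<iota> * U $ j $ \<iota>) *\<^sub>R g t \<iota>) \<bullet> h)) (at \<theta>)"
      by (rule has_derivative_transform_within_open[OF _ neighborhood(1,2)])
        (use entries that neighborhood(3) in auto)
    then show ?thesis
      by (simp add: partial_eq partial_eq[OF g[OF that]])
  qed

  \<comment> \<open>Entries of the information matrix\<close>
  let ?d = "\<lambda>t a \<iota>. partial a (\<lambda>\<theta>. lam (real t) \<theta> $ \<iota>) \<theta>"
  have info: "J $ a $ b = (\<Sum>t=0..T. \<Sum>\<iota>\<in>UNIV. \<Sum>\<gamma>\<in>UNIV.
      ?d t a \<iota> * ?d t b \<gamma> * eig_coupling U (P (real t) \<theta>) \<iota> \<gamma>)" for a b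
    unfolding fisher_info_def vec_lambda_beta
  proof (rule sum.cong[OF refl])
    fix t assume "t \<in> {0..T}"
    then have "t \<le> T" by simp
    let ?q = "\<lambda>i j. P (real t) \<theta> $ i $ j * (1 - P (real t) \<theta> $ i $ j)"
    let ?u = "\<lambda>i j \<iota>. U $ i $ \<iota> * U $ j $ \<iota>"
    have "(\<Sum>(i, j) | i < j. partial a (\<lambda>\<theta>. P (real t) \<theta> $ i $ j) \<theta> * partial b (\<lambda>\<theta>. P (real t) \<theta> $ i $ j) \<theta> * (1 / ?q i j))
        = (\<Sum>(i, j) | i < j. \<Sum>\<iota>\<in>UNIV. \<Sum>\<gamma>\<in>UNIV. ?d t a \<iota> * ?d t b \<gamma> * (?u i j \<iota> * ?u i j \<gamma> / ?q i j))"
      unfolding partial_P[OF \<open>t \<le> T\<close>] sum_product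
      unfolding sum_distrib_right by (simp add: mult_ac)
    also have "\<dots> = (\<Sum>\<iota>\<in>UNIV. \<Sum>\<gamma>\<in>UNIV. \<Sum>(i, j) | i < j. ?d t a \<iota> * ?d t b \<gamma> * (?u i j \<iota> * ?u i j \<gamma> / ?q i j))"
      unfolding split_def by (subst sum.swap) (intro sum.cong refl sum.swap)
    also have "\<dots> = (\<Sum>\<iota>\<in>UNIV. \<Sum>\<gamma>\<in>UNIV. ?d t a \<iota> * ?d t b \<gamma> * eig_coupling U (P (real t) \<theta>) \<iota> \<gamma>)"
      unfolding eig_coupling_def sum_distrib_left split_def by (simp add: mult_ac)
    finally show "(\<Sum>(i, j) | i < j. partial a (\<lambda>\<theta>. P (real t) \<theta> $ i $ j) \<theta> * partial b (\<lambda>\<theta>. P (real t) \<theta> $ i $ j) \<theta> * (1 / ?q i j))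
      = (\<Sum>\<iota>\<in>UNIV. \<Sum>\<gamma>\<in>UNIV. ?d t a \<iota> * ?d t b \<gamma> * eig_coupling U (P (real t) \<theta>) \<iota> \<gamma>)" .
  qed
  have weight: "eig_coupling U Q \<iota> \<iota> = eig_weight U Q \<iota>" for Q \<iota>
    by (simp add: eig_coupling_def eig_weight_def power2_eq_square mult_ac)
  have diagonal: "J $ a $ a = (\<Sum>t=0..T. \<Sum>\<iota>\<in>UNIV. (?d t a \<iota>)\<^sup>2 * eig_weight U (P (real t) \<theta>) \<iota>)
      + cross_terms T P U lam \<theta> a" for a
    unfolding info cross_terms_def sum.distrib[symmetric]
  proof (rule sum.cong[OF refl])
    fix t
    let ?f = "\<lambda>\<iota> \<gamma>. ?d t a \<iota> * ?d t a \<gamma> * eig_coupling U (P (real t) \<theta>) \<iota> \<gamma>"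
    have "(\<Sum>\<iota>\<in>UNIV. \<Sum>\<gamma>\<in>UNIV. ?f \<iota> \<gamma>) = (\<Sum>(\<iota>, \<gamma>)\<in>UNIV. ?f \<iota> \<gamma>)"
      by (simp add: sum.cartesian_product)
    also have "(UNIV :: ('d \<times> 'd) set) = range (\<lambda>\<iota>. (\<iota>, \<iota>)) \<union> {(\<iota>, \<gamma>). \<iota> \<noteq> \<gamma>}"
      by auto
    also have "(\<Sum>(\<iota>, \<gamma>)\<in>\<dots>. ?f \<iota> \<gamma>) = (\<Sum>(\<iota>, \<gamma>)\<in>range (\<lambda>\<iota>. (\<iota>, \<iota>)). ?f \<iota> \<gamma>) + (\<Sum>(\<iota>, \<gamma>) | \<iota> \<noteq> \<gamma>. ?f \<iota> \<gamma>)"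
      by (rule sum.union_disjoint) auto
    also have "(\<Sum>(\<iota>, \<gamma>)\<in>range (\<lambda>\<iota>. (\<iota>, \<iota>)). ?f \<iota> \<gamma>) = (\<Sum>\<iota>\<in>UNIV. ?f \<iota> \<iota>)"
      by (subst sum.reindex) (auto intro: injI)
    finally show "(\<Sum>\<iota>\<in>UNIV. \<Sum>\<gamma>\<in>UNIV. ?f \<iota> \<gamma>) =
        (\<Sum>\<iota>\<in>UNIV. (?d t a \<iota>)\<^sup>2 * eig_weight U (P (real t) \<theta>) \<iota>) + (\<Sum>(\<iota>, \<gamma>) | \<iota> \<noteq> \<gamma>. ?f \<iota> \<gamma>)"
      by (simp add: weight power2_eq_square)
  qed

  \<comment> \<open>Lower bounds for the estimator\<close>
  note pd = information_pos_def
  have diag: "1 / J $ a $ a \<le> pinv J $ a $ a" if "axis a 1 \<in> S" for a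
    by (rule pinv_diagonal_ge[OF pd that])
  have norms: "trace (pinv J) \<le> E (\<lambda>A. (norm (est A - \<theta>))\<^sup>2)"
      "trace (pinv J) \<le> E (\<lambda>A. (norm (closest_point S (est A - \<theta>)))\<^sup>2)"
    if "unbiased_along T P \<Theta> S \<theta> est" for est
    using expectation_norm_ge[OF pd that neighborhood(3)] expectation_projected_norm_ge[OF pd that neighborhood(3)] .
  have var: "pinv J $ a $ a \<le> measure_pmf.variance (data_law T P \<theta>) (\<lambda>A. est A $ a)"
      "1 / J $ a $ a \<le> measure_pmf.variance (data_law T P \<theta>) (\<lambda>A. est A $ a)"
    if "unbiased_along T P \<Theta> S \<theta> est" "axis a 1 \<in> S" for est a
    using variance_component_ge[OF pd that(2,1) neighborhood(3)] diag[OF that(2)] by linarith+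
  \<comment> \<open>When the information is invertible, the identifiable subspace is the whole space
    and the pseudoinverse is the inverse, so these claims specialise the bounds on
    \<open>S\<close>.\<close>
  have "(\<forall>a. 1 / J $ a $ a \<le> matrix_inv J $ a $ a) \<and>
      (\<forall>est. unbiased T P \<Theta> est \<longrightarrow>
         trace (matrix_inv J) \<le> E (\<lambda>A. (norm (est A - \<theta>))\<^sup>2) \<and>
         (\<forall>a. matrix_inv J $ a $ a \<le> measure_pmf.variance (data_law T P \<theta>) (\<lambda>A. est A $ a) \<and>
              1 / J $ a $ a \<le> measure_pmf.variance (data_law T P \<theta>) (\<lambda>A. est A $ a)))"
    if inv: "invertible J"
  proof -
    have "axis a 1 \<in> S" for a
      using identifiable_subspace_UNIV[OF inv] by simp
    then show ?thesis
      using diag norms var unbiased_imp_unbiased_along unfolding pinv_invertible[OF inv, symmetric] by blast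
  qed
  moreover have "(\<forall>a. axis a 1 \<in> S \<longrightarrow> 1 / J $ a $ a \<le> pinv J $ a $ a) \<and>
      (\<forall>est. unbiased_along T P \<Theta> S \<theta> est \<longrightarrow>
         trace (pinv J) \<le> E (\<lambda>A. (norm (est A - \<theta>))\<^sup>2) \<and>
         trace (pinv J) \<le> E (\<lambda>A. (norm (closest_point S (est A - \<theta>)))\<^sup>2) \<and>
         (\<forall>a. axis a 1 \<in> S \<longrightarrow>
            pinv J $ a $ a \<le> measure_pmf.variance (data_law T P \<theta>) (\<lambda>A. est A $ a) \<and>
            1 / J $ a $ a \<le> measure_pmf.variance (data_law T P \<theta>) (\<lambda>A. est A $ a)))"
    using diag norms var by blast
  ultimately show ?thesis
    unfolding Let_def diagonal[symmetric] using info weight by blast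
qed

end
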